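(* Let $\mathbb{F}$ be a field, let $G$ be a group, let $X$ be a finite poset, and let the incidence algebra $I(X)$ over $\mathbb{F}$ be endowed with a $G$-grading. Assume that at least one of the following holds: $\operatorname{char}\mathbb{F}=0$; $\operatorname{char}\mathbb{F}>\dim_{\mathbb{F}} I(X)$; or $G$ is abelian. Then there exist finite abelian subgroups $H_1,\ldots,H_t\subseteq G$ such that for each $i=1,\ldots,t$, $\operatorname{char}\mathbb{F}$ does not divide $|H_i|$ and $\mathbb{F}$ contains a primitive $\exp(H_i)$-th root of $1$, and such that there is an isomorphism of $G$-graded algebras $$ I(X)\cong\left(\begin{array}{cccc}\mathbb{F}H_1&M_{1,2}&\ldots&M_{1,t}\\&\mathbb{F}H_2&\ddots&\vdots\\&&\ddots&M_{t-1,t}\\&&&\mathbb{F}H_t\end{array}\right), $$ where each $M_{i,j}$ ($i<j$) is a $G$-graded $(\mathbb{F}H_i,\mathbb{F}H_j)$-bimodule.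
   Context: For a finite poset $(X,\le)$, the incidence algebra is $I(X)=\{f:X\times X\to\mathbb{F}\mid f(x,y)=0 \text{ whenever } x\not\le y\}$ with pointwise addition and scalar multiplication and product $(fg)(x,y)=\sum_{z\in X}f(x,z)g(z,y)$. A $G$-grading on an algebra $A$ is a vector space decomposition $A=\bigoplus_{g\in G}A_g$ (components possibly zero) with $A_gA_h\subseteq A_{gh}$; graded isomorphisms are algebra isomorphisms that preserve each homogeneous component. Graded bimodules are bimodules with a vector space decomposition indexed by $G$ compatible with the gradings of the acting algebras. For a subgroup $H\subseteq G$, the group algebra $\mathbb{F}H$ is $G$-graded by $\deg h=h$ for $h\in H$. The block upper triangular matrix denotes a $G$-graded algebra which, as a graded vector space, is the direct sum of the diagonal blocks $\mathbb{F}H_i$ and the blocks $M_{i,j}$, $i<j$, with matrix-type multiplication: it uses the products of the $\mathbb{F}H_i$, the bimodule actions, and degree-preserving bilinear products $M_{i,j}\times M_{j,k}\to M_{i,k}$ for $i<j<k$ (other products of blocks being zero). *)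

theory Defs
  imports
    Complex_Main
    "HOL-Algebra.Group"
    "HOL-Library.Function_Algebras"
    "HOL-Library.Product_Plus"
begin

text \<open>
  A vector space over the field \<open>'f\<close> is a subspace of an ambient type of class
  \<open>ab_group_add\<close> with a scalar multiplication satisfying \<^locale>\<open>vector_space\<close>.
  For function types the ambient addition is pointwise. The multiplications of algebras are
  explicit; the pointwise product of functions is never used.
\<close>

definition fscale :: "'f::field \<Rightarrow> ('k \<Rightarrow> 'f) \<Rightarrow> 'k \<Rightarrow> 'f" where
  "fscale c f = (\<lambda>k. c * f k)"


section \<open>Graded vector spaces, algebras and bimodules\<close>

text \<open>
  The last condition says that \<open>V\<close> is the internal direct sum of the \<open>D g\<close>, where \<open>g\<close> ranges
  over \<^term>\<open>carrier G\<close>.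
\<close>

definition graded_space ::
  "('g, 'h) monoid_scheme \<Rightarrow> ('f::field \<Rightarrow> 'v::ab_group_add \<Rightarrow> 'v) \<Rightarrow> 'v set \<Rightarrow> ('g \<Rightarrow> 'v set) \<Rightarrow> bool"
where
  "graded_space G s V D \<longleftrightarrow>
     vector_space s \<and> module.subspace s V \<and>
     (\<forall>g\<in>carrier G. module.subspace s (D g) \<and> D g \<subseteq> V) \<and>
     (\<forall>v\<in>V. \<exists>!c. (\<forall>g\<in>carrier G. c g \<in> D g) \<and> (\<forall>g. g \<notin> carrier G \<longrightarrow> c g = 0) \<and>
        finite {g. c g \<noteq> 0} \<and> v = (\<Sum>g | c g \<noteq> 0. c g))"

record ('f, 'a, 'g) graded_alg =
  Space :: "'a set"
  Scale :: "'f \<Rightarrow> 'a \<Rightarrow> 'a"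
  Mult :: "'a \<Rightarrow> 'a \<Rightarrow> 'a"
  Unit :: "'a"
  Comp :: "'g \<Rightarrow> 'a set"

definition bilinear_into ::
  "('f \<Rightarrow> 'u \<Rightarrow> 'u) \<Rightarrow> ('f \<Rightarrow> 'v \<Rightarrow> 'v) \<Rightarrow> ('f \<Rightarrow> 'w \<Rightarrow> 'w) \<Rightarrow>
   'u::ab_group_add set \<Rightarrow> 'v::ab_group_add set \<Rightarrow> 'w::ab_group_add set \<Rightarrow> ('u \<Rightarrow> 'v \<Rightarrow> 'w) \<Rightarrow> bool"
where
  "bilinear_into s1 s2 s3 U V W b \<longleftrightarrow>
     (\<forall>u\<in>U. \<forall>v\<in>V. b u v \<in> W) \<and>
     (\<forall>u\<in>U. \<forall>u'\<in>U. \<forall>v\<in>V. b (u + u') v = b u v + b u' v) \<and>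
     (\<forall>u\<in>U. \<forall>v\<in>V. \<forall>v'\<in>V. b u (v + v') = b u v + b u v') \<and>
     (\<forall>c. \<forall>u\<in>U. \<forall>v\<in>V. b (s1 c u) v = s3 c (b u v)) \<and>
     (\<forall>c. \<forall>u\<in>U. \<forall>v\<in>V. b u (s2 c v) = s3 c (b u v))"

definition degree_compatible ::
  "('g, 'h) monoid_scheme \<Rightarrow> ('g \<Rightarrow> 'u set) \<Rightarrow> ('g \<Rightarrow> 'v set) \<Rightarrow> ('g \<Rightarrow> 'w set) \<Rightarrow>
   ('u \<Rightarrow> 'v \<Rightarrow> 'w) \<Rightarrow> bool"
where
  "degree_compatible G D E K b \<longleftrightarrow>
     (\<forall>g\<in>carrier G. \<forall>h\<in>carrier G. \<forall>u\<in>D g. \<forall>v\<in>E h. b u v \<in> K (g \<otimes>\<^bsub>G\<^esub> h))"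

definition graded_algebra ::
  "('g, 'h) monoid_scheme \<Rightarrow> ('f::field, 'a::ab_group_add, 'g) graded_alg \<Rightarrow> bool"
where
  "graded_algebra G A \<longleftrightarrow>
     graded_space G (Scale A) (Space A) (Comp A) \<and>
     bilinear_into (Scale A) (Scale A) (Scale A) (Space A) (Space A) (Space A) (Mult A) \<and>
     (\<forall>a\<in>Space A. \<forall>b\<in>Space A. \<forall>c\<in>Space A. Mult A (Mult A a b) c = Mult A a (Mult A b c)) \<and>
     Unit A \<in> Space A \<and>
     (\<forall>a\<in>Space A. Mult A (Unit A) a = a \<and> Mult A a (Unit A) = a) \<and>
     degree_compatible G (Comp A) (Comp A) (Comp A) (Mult A)"

definition graded_alg_iso ::
  "('g, 'h) monoid_scheme \<Rightarrow> ('f::field, 'a::ab_group_add, 'g) graded_alg \<Rightarrow>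
   ('f, 'b::ab_group_add, 'g) graded_alg \<Rightarrow> ('a \<Rightarrow> 'b) \<Rightarrow> bool"
where
  "graded_alg_iso G A B \<phi> \<longleftrightarrow>
     bij_betw \<phi> (Space A) (Space B) \<and>
     (\<forall>a\<in>Space A. \<forall>b\<in>Space A. \<phi> (a + b) = \<phi> a + \<phi> b) \<and>
     (\<forall>c. \<forall>a\<in>Space A. \<phi> (Scale A c a) = Scale B c (\<phi> a)) \<and>
     (\<forall>a\<in>Space A. \<forall>b\<in>Space A. \<phi> (Mult A a b) = Mult B (\<phi> a) (\<phi> b)) \<and>
     \<phi> (Unit A) = Unit B \<and>
     (\<forall>g\<in>carrier G. \<phi> ` Comp A g = Comp B g)"

record ('a, 'b, 'm, 'g) graded_bimod =
  BSpace :: "'m set"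
  LAct :: "'a \<Rightarrow> 'm \<Rightarrow> 'm"
  RAct :: "'m \<Rightarrow> 'b \<Rightarrow> 'm"
  BComp :: "'g \<Rightarrow> 'm set"

definition graded_bimodule ::
  "('g, 'h) monoid_scheme \<Rightarrow> ('f::field \<Rightarrow> 'm::ab_group_add \<Rightarrow> 'm) \<Rightarrow>
   ('f, 'a::ab_group_add, 'g) graded_alg \<Rightarrow> ('f, 'b::ab_group_add, 'g) graded_alg \<Rightarrow>
   ('a, 'b, 'm, 'g) graded_bimod \<Rightarrow> bool"
where
  "graded_bimodule G s A B M \<longleftrightarrow>
     graded_space G s (BSpace M) (BComp M) \<and>
     bilinear_into (Scale A) s s (Space A) (BSpace M) (BSpace M) (LAct M) \<and>
     bilinear_into s (Scale B) s (BSpace M) (Space B) (BSpace M) (RAct M) \<and>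
     (\<forall>a\<in>Space A. \<forall>a'\<in>Space A. \<forall>m\<in>BSpace M. LAct M (Mult A a a') m = LAct M a (LAct M a' m)) \<and>
     (\<forall>m\<in>BSpace M. \<forall>b\<in>Space B. \<forall>b'\<in>Space B. RAct M m (Mult B b b') = RAct M (RAct M m b) b') \<and>
     (\<forall>a\<in>Space A. \<forall>m\<in>BSpace M. \<forall>b\<in>Space B. RAct M (LAct M a m) b = LAct M a (RAct M m b)) \<and>
     (\<forall>m\<in>BSpace M. LAct M (Unit A) m = m \<and> RAct M m (Unit B) = m) \<and>
     degree_compatible G (Comp A) (BComp M) (BComp M) (LAct M) \<and>
     degree_compatible G (BComp M) (Comp B) (BComp M) (RAct M)"


section \<open>Incidence algebras\<close>

text \<open>
  The poset is a set \<open>X\<close> with its order relation \<open>r \<subseteq> X \<times> X\<close>, where \<open>(x, y) \<in> r\<close> means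
  \<open>x \<le> y\<close>, so functions in the incidence
  space vanish outside \<open>X \<times> X\<close>. The family \<open>D\<close> collects the homogeneous components.
\<close>

definition incidence_space :: "('x \<times> 'x) set \<Rightarrow> ('x \<times> 'x \<Rightarrow> 'f::field) set" where
  "incidence_space r = {f. \<forall>x y. (x, y) \<notin> r \<longrightarrow> f (x, y) = 0}"

definition incidence_algebra ::
  "'x set \<Rightarrow> ('x \<times> 'x) set \<Rightarrow> ('g \<Rightarrow> ('x \<times> 'x \<Rightarrow> 'f::field) set) \<Rightarrow> ('f, 'x \<times> 'x \<Rightarrow> 'f, 'g) graded_alg"
where
  "incidence_algebra X r D =
     \<lparr>Space = incidence_space r,
      Scale = fscale,
      Mult = (\<lambda>f g. \<lambda>(x, y). \<Sum>z\<in>X. f (x, z) * g (z, y)),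
      Unit = (\<lambda>(x, y). if x = y \<and> x \<in> X then 1 else 0),
      Comp = D\<rparr>"


section \<open>Group algebras of subgroups\<close>

definition group_algebra ::
  "('g, 'h) monoid_scheme \<Rightarrow> 'g set \<Rightarrow> ('f::field, 'g \<Rightarrow> 'f, 'g) graded_alg"
where
  "group_algebra G H =
     \<lparr>Space = {a. finite {h. a h \<noteq> 0} \<and> {h. a h \<noteq> 0} \<subseteq> H},
      Scale = fscale,
      Mult = (\<lambda>a b k. \<Sum>(g, h) | a g \<noteq> 0 \<and> b h \<noteq> 0 \<and> g \<otimes>\<^bsub>G\<^esub> h = k. a g * b h),
      Unit = (\<lambda>h. if h = \<one>\<^bsub>G\<^esub> then 1 else 0),
      Comp = (\<lambda>g. {a. {h. a h \<noteq> 0} \<subseteq> H \<inter> {g}})\<rparr>"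

text \<open>Meaningful when such an \<open>n\<close> exists, in particular for every finite subgroup \<open>H\<close>.\<close>

definition group_exponent :: "('g, 'h) monoid_scheme \<Rightarrow> 'g set \<Rightarrow> nat" where
  "group_exponent G H = (LEAST n. n > 0 \<and> (\<forall>h\<in>H. h [^]\<^bsub>G\<^esub> n = \<one>\<^bsub>G\<^esub>))"

definition primitive_root_of_unity :: "nat \<Rightarrow> 'f::field \<Rightarrow> bool" where
  "primitive_root_of_unity n z \<longleftrightarrow> n > 0 \<and> z ^ n = 1 \<and> (\<forall>k. 0 < k \<and> k < n \<longrightarrow> z ^ k \<noteq> 1)"


section \<open>Block upper triangular algebras\<close>

text \<open>
  Blocks are numbered \<open>0, \<dots>, t - 1\<close>. The diagonal blocks are the group algebras of the \<open>H i\<close>,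
  the blocks \<open>M i j\<close> with \<open>i < j\<close> live in a common ambient vector space with scalar
  multiplication \<open>s\<close>, and \<open>p i j k\<close> is the product of \<open>M i j\<close> and \<open>M j k\<close>.
\<close>

definition triangular_data ::
  "('g, 'h) monoid_scheme \<Rightarrow> ('f::field \<Rightarrow> 'm::ab_group_add \<Rightarrow> 'm) \<Rightarrow> nat \<Rightarrow> (nat \<Rightarrow> 'g set) \<Rightarrow>
   (nat \<Rightarrow> nat \<Rightarrow> ('g \<Rightarrow> 'f, 'g \<Rightarrow> 'f, 'm, 'g) graded_bimod) \<Rightarrow>
   (nat \<Rightarrow> nat \<Rightarrow> nat \<Rightarrow> 'm \<Rightarrow> 'm \<Rightarrow> 'm) \<Rightarrow> bool"
where
  "triangular_data G s t H M p \<longleftrightarrow>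
     (\<forall>i j. i < j \<and> j < t \<longrightarrow>
        graded_bimodule G s (group_algebra G (H i)) (group_algebra G (H j)) (M i j)) \<and>
     (\<forall>i j k. i < j \<and> j < k \<and> k < t \<longrightarrow>
        bilinear_into s s s (BSpace (M i j)) (BSpace (M j k)) (BSpace (M i k)) (p i j k) \<and>
        degree_compatible G (BComp (M i j)) (BComp (M j k)) (BComp (M i k)) (p i j k))"

text \<open>
  A matrix is a pair \<open>(d, m)\<close> of its diagonal entries \<open>d i\<close> and its entries \<open>m i j\<close> above the
  diagonal; entries at all other indices are \<open>0\<close>.
\<close>

definition triangular_algebra ::
  "('g, 'h) monoid_scheme \<Rightarrow> ('f::field \<Rightarrow> 'm::ab_group_add \<Rightarrow> 'm) \<Rightarrow> nat \<Rightarrow> (nat \<Rightarrow> 'g set) \<Rightarrow>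
   (nat \<Rightarrow> nat \<Rightarrow> ('g \<Rightarrow> 'f, 'g \<Rightarrow> 'f, 'm, 'g) graded_bimod) \<Rightarrow>
   (nat \<Rightarrow> nat \<Rightarrow> nat \<Rightarrow> 'm \<Rightarrow> 'm \<Rightarrow> 'm) \<Rightarrow>
   ('f, (nat \<Rightarrow> 'g \<Rightarrow> 'f) \<times> (nat \<Rightarrow> nat \<Rightarrow> 'm), 'g) graded_alg"
where
  "triangular_algebra G s t H M p =
     (let FH = (\<lambda>i. group_algebra G (H i) :: ('f, 'g \<Rightarrow> 'f, 'g) graded_alg);
          matrices = (\<lambda>P Q. {(d, m).
            (\<forall>i. if i < t then d i \<in> P i else d i = 0) \<and>
            (\<forall>i j. if i < j \<and> j < t then m i j \<in> Q i j else m i j = 0)})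
      in \<lparr>Space = matrices (\<lambda>i. Space (FH i)) (\<lambda>i j. BSpace (M i j)),
          Scale = (\<lambda>c (d, m). (\<lambda>i. fscale c (d i), \<lambda>i j. s c (m i j))),
          Mult = (\<lambda>(d, m) (d', m').
            (\<lambda>i. if i < t then Mult (FH i) (d i) (d' i) else 0,
             \<lambda>i k. if i < k \<and> k < t
               then LAct (M i k) (d i) (m' i k) + RAct (M i k) (m i k) (d' k)
                 + (\<Sum>j\<in>{i<..<k}. p i j k (m i j) (m' j k))
               else 0)),
          Unit = (\<lambda>i. if i < t then Unit (FH i) else 0, \<lambda>i j. 0),
          Comp = (\<lambda>g. matrices (\<lambda>i. Comp (FH i) g) (\<lambda>i j. BComp (M i j) g))\<rparr>)"

end

theory Submission
  imports Defs "HOL-Algebra.Multiplicative_Group" "HOL-Computational_Algebra.Primes"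
begin

text \<open>
  The radical \<open>J\<close> of \<open>I(X)\<close> consists of the functions vanishing on the diagonal. It is graded: if \<open>G\<close>
  is abelian, because it is the space of commutators; otherwise, because homogeneous elements of
  degree \<open>\<noteq> 1\<close> have trace \<open>0\<close> in the regular representation and the trace is
  \<open>\<Sum>x. |{y. x \<le> y}| f (x, x)\<close> with nonzero weights.

  Hence \<open>I(X) / J\<close>, the algebra of functions on \<open>X\<close>, is graded. Its part of degree \<open>1\<close> consists of the
  functions constant on the blocks of a partition of \<open>X\<close>. A nonzero homogeneous function on a block
  has a power of degree \<open>1\<close> and so vanishes nowhere on it; normalized at a base point, such functions
  form a basis of a group algebra \<open>FH\<close>, whose characters are the evaluations at the points of the block.
  These separate the points of \<open>H\<close>, which yields the root of unity.

  Finally the indicators of the blocks lift to orthogonal idempotents \<open>e i\<close> of degree \<open>1\<close>. For a nonzero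
  homogeneous \<open>b\<close> in \<open>J\<close> with \<open>b = e i b e j\<close>, every point of block \<open>i\<close> lies strictly below some point of
  block \<open>j\<close>. Thus the greatest height of a point increases strictly from block \<open>i\<close> to block \<open>j\<close>.
  Ordering the blocks by this number makes the Peirce decomposition triangular, and
  \<open>e i J e i = 0\<close> shows that its diagonal blocks are the group algebras.
\<close>

section \<open>Functions into the field as a vector space\<close>

lemma fun_sum_apply: "(\<Sum>i\<in>I. f i) x = (\<Sum>i\<in>I. f i x)"
  for f :: "'i \<Rightarrow> 'k \<Rightarrow> 'f::comm_monoid_add"
  by (induction I rule: infinite_finite_induct) auto

interpretation fun_space: vector_space "fscale :: 'f::field \<Rightarrow> ('k \<Rightarrow> 'f) \<Rightarrow> 'k \<Rightarrow> 'f"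
  by standard (auto simp: fscale_def fun_eq_iff algebra_simps)

lemma fscale_apply [simp]: "fscale c f k = c * f k"
  by (simp add: fscale_def)

section \<open>Convolution of functions on pairs\<close>

text \<open>Acts on all functions on pairs, so that associativity and bilinearity hold without
  membership conditions; only the unit laws and the diagonal rule refer to the order.\<close>

definition conv :: "'x set \<Rightarrow> ('x \<times> 'x \<Rightarrow> 'f::field) \<Rightarrow> ('x \<times> 'x \<Rightarrow> 'f) \<Rightarrow> 'x \<times> 'x \<Rightarrow> 'f" where
  "conv X f g = (\<lambda>(x, y). \<Sum>z\<in>X. f (x, z) * g (z, y))"

definition conv_one :: "'x set \<Rightarrow> 'x \<times> 'x \<Rightarrow> 'f::field" where
  "conv_one X = (\<lambda>(x, y). if x = y \<and> x \<in> X then 1 else 0)"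

definition matrix_unit :: "'k \<Rightarrow> 'k \<Rightarrow> 'f::field" where
  "matrix_unit b = (\<lambda>q. if q = b then 1 else 0)"

lemma conv_apply: "conv X f g (x, y) = (\<Sum>z\<in>X. f (x, z) * g (z, y))"
  by (simp add: conv_def)

lemma matrix_unit_apply: "matrix_unit b q = (if q = b then 1 else 0)"
  by (simp add: matrix_unit_def)

lemma conv_assoc: "conv X (conv X f g) h = conv X f (conv X g h)"
proof (rule ext, clarify)
  fix x y
  have "conv X (conv X f g) h (x, y) = (\<Sum>w\<in>X. \<Sum>z\<in>X. f (x, z) * g (z, w) * h (w, y))"
    by (simp add: conv_apply sum_distrib_right)
  also have "\<dots> = (\<Sum>z\<in>X. \<Sum>w\<in>X. f (x, z) * g (z, w) * h (w, y))"
    by (rule sum.swap)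
  also have "\<dots> = conv X f (conv X g h) (x, y)"
    by (simp add: conv_apply sum_distrib_left mult.assoc)
  finally show "conv X (conv X f g) h (x, y) = conv X f (conv X g h) (x, y)" .
qed

lemma conv_add_left: "conv X (f + g) h = conv X f h + conv X g h"
  and conv_add_right: "conv X h (f + g) = conv X h f + conv X h g"
  and conv_diff_left: "conv X (f - g) h = conv X f h - conv X g h"
  and conv_diff_right: "conv X h (f - g) = conv X h f - conv X h g"
  and conv_zero_left [simp]: "conv X 0 h = 0"
  and conv_zero_right [simp]: "conv X h 0 = 0"
  and conv_scale_left: "conv X (fscale c f) h = fscale c (conv X f h)"
  and conv_scale_right: "conv X h (fscale c f) = fscale c (conv X h f)"
  by (auto simp: fun_eq_iff conv_apply algebra_simps sum.distrib sum_subtractf sum_distrib_left)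

lemma conv_sum_left: "conv X (\<Sum>i\<in>I. f i) h = (\<Sum>i\<in>I. conv X (f i) h)"
proof (cases "finite I")
  case True
  then show ?thesis
    by (induct rule: finite_induct) (simp_all only: sum.empty sum.insert simp_thms conv_zero_left conv_add_left)
qed simp

lemma conv_sum_right: "conv X h (\<Sum>i\<in>I. f i) = (\<Sum>i\<in>I. conv X h (f i))"
proof (cases "finite I")
  case True
  then show ?thesis
    by (induct rule: finite_induct) (simp_all only: sum.empty sum.insert simp_thms conv_zero_right conv_add_right)
qed simp

lemmas conv_distribs = conv_add_left conv_add_right conv_diff_left conv_diff_right

section \<open>Gradings of incidence algebras\<close>

locale graded_incidence = group G
  for G :: "('g, 'h) monoid_scheme" (structure) +
  fixes X :: "'x set" and r :: "('x \<times> 'x) set"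
    and D :: "'g \<Rightarrow> ('x \<times> 'x \<Rightarrow> 'f::field) set"
  assumes finite_X: "finite X"
    and partial_order: "partial_order_on X r"
    and graded: "graded_algebra G (incidence_algebra X r D)"
begin

abbreviation A :: "('x \<times> 'x \<Rightarrow> 'f) set" where
  "A \<equiv> incidence_space r"

abbreviation mul :: "('x \<times> 'x \<Rightarrow> 'f) \<Rightarrow> ('x \<times> 'x \<Rightarrow> 'f) \<Rightarrow> 'x \<times> 'x \<Rightarrow> 'f" (infixl "\<star>" 70) where
  "f \<star> g \<equiv> conv X f g"

abbreviation U :: "'x \<times> 'x \<Rightarrow> 'f" where
  "U \<equiv> conv_one X"

abbreviation E :: "'x \<times> 'x \<Rightarrow> 'x \<times> 'x \<Rightarrow> 'f" where
  "E \<equiv> matrix_unit"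

lemma r_subset: "r \<subseteq> X \<times> X"
  and r_refl: "x \<in> X \<Longrightarrow> (x, x) \<in> r"
  and r_trans: "(x, y) \<in> r \<Longrightarrow> (y, z) \<in> r \<Longrightarrow> (x, z) \<in> r"
  and r_antisym: "(x, y) \<in> r \<Longrightarrow> (y, x) \<in> r \<Longrightarrow> x = y"
  using partial_order
  unfolding partial_order_on_def preorder_on_def refl_on_def trans_def antisym_def by blast+

lemma finite_r [simp]: "finite r"
  using finite_X r_subset by (meson finite_SigmaI finite_subset)

lemma A_zero: "f \<in> A \<Longrightarrow> b \<notin> r \<Longrightarrow> f b = 0"
  by (cases b) (auto simp: incidence_space_def)

lemma A_I: "(\<And>b. b \<notin> r \<Longrightarrow> f b = 0) \<Longrightarrow> f \<in> A"
  by (auto simp: incidence_space_def)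

lemma A_subspace: "fun_space.subspace A"
  by (simp add: fun_space.subspace_def incidence_space_def)

lemmas A_closed [simp, intro] =
  fun_space.subspace_0[OF A_subspace] fun_space.subspace_add[OF A_subspace]
  fun_space.subspace_diff[OF A_subspace] fun_space.subspace_scale[OF A_subspace]
  fun_space.subspace_sum[OF A_subspace]

lemma U_in_A [simp]: "U \<in> A"
  by (auto simp: conv_one_def r_refl intro!: A_I)

lemma E_in_A [simp]: "b \<in> r \<Longrightarrow> E b \<in> A"
  by (auto simp: matrix_unit_def intro!: A_I)

lemma mul_in_A [simp, intro]:
  assumes "f \<in> A" "g \<in> A" shows "f \<star> g \<in> A"
proof (rule A_I)
  fix b assume b: "b \<notin> r"
  obtain x y where xy: "b = (x, y)" by (cases b)
  have "f (x, z) * g (z, y) = 0" for z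
    using A_zero[OF assms(1), of "(x, z)"] A_zero[OF assms(2), of "(z, y)"] r_trans b xy
    by (cases "(x, z) \<in> r") auto
  then show "(f \<star> g) b = 0"
    by (simp add: xy conv_apply del: mult_eq_0_iff)
qed

lemma mul_U_left [simp]:
  assumes "f \<in> A" shows "U \<star> f = f"
proof (rule ext, clarify)
  fix x y
  have "(U \<star> f) (x, y) = (\<Sum>z\<in>X. if x = z then f (z, y) else 0)"
    by (auto simp: conv_apply conv_one_def intro!: sum.cong)
  also have "\<dots> = f (x, y)"
    using finite_X A_zero[OF assms, of "(x, y)"] r_subset by auto
  finally show "(U \<star> f) (x, y) = f (x, y)" .
qed

lemma mul_U_right [simp]:
  assumes "f \<in> A" shows "f \<star> U = f"
proof (rule ext, clarify)
  fix x y
  have "(f \<star> U) (x, y) = (\<Sum>z\<in>X. if z = y then f (x, z) else 0)"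
    by (auto simp: conv_apply conv_one_def intro!: sum.cong)
  also have "\<dots> = f (x, y)"
    using finite_X A_zero[OF assms, of "(x, y)"] r_subset by auto
  finally show "(f \<star> U) (x, y) = f (x, y)" .
qed

text \<open>By antisymmetry only \<open>z = x\<close> contributes to the sum. Evaluation at a
  diagonal place is thus a character of \<open>A\<close>.\<close>

lemma mul_diag [simp]:
  assumes "f \<in> A" "g \<in> A" "x \<in> X"
  shows "(f \<star> g) (x, x) = f (x, x) * g (x, x)"
proof -
  have "(f \<star> g) (x, x) = (\<Sum>z\<in>X. if z = x then f (x, x) * g (x, x) else 0)"
    unfolding conv_apply
  proof (rule sum.cong)
    fix z assume "z \<in> X"
    show "f (x, z) * g (z, x) = (if z = x then f (x, x) * g (x, x) else 0)"
      using A_zero[OF assms(1), of "(x, z)"] A_zero[OF assms(2), of "(z, x)"] r_antisym[of x z]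
      by (cases "(x, z) \<in> r") auto
  qed simp
  then show ?thesis using assms(3) finite_X by simp
qed

lemma U_diag [simp]: "x \<in> X \<Longrightarrow> U (x, x) = 1"
  by (simp add: conv_one_def)

lemma A_expand:
  assumes "f \<in> A" shows "f = (\<Sum>b\<in>r. fscale (f b) (E b))"
proof
  fix q
  have "(\<Sum>b\<in>r. fscale (f b) (E b)) q = (\<Sum>b\<in>r. if b = q then f q else 0)"
    unfolding fun_sum_apply by (rule sum.cong) (auto simp: matrix_unit_apply)
  also have "\<dots> = f q"
    using A_zero[OF assms, of q] by simp
  finally show "f q = (\<Sum>b\<in>r. fscale (f b) (E b)) q" by simp
qed

lemma incidence_algebra_eq:
  "incidence_algebra X r D = \<lparr>Space = A, Scale = fscale, Mult = (\<star>), Unit = U, Comp = D\<rparr>"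
  by (simp add: incidence_algebra_def conv_def[abs_def] conv_one_def)

lemma D_subspace: "g \<in> carrier G \<Longrightarrow> fun_space.subspace (D g)"
  and D_in_A: "g \<in> carrier G \<Longrightarrow> a \<in> D g \<Longrightarrow> a \<in> A"
  and D_mult: "g \<in> carrier G \<Longrightarrow> h \<in> carrier G \<Longrightarrow> a \<in> D g \<Longrightarrow> b \<in> D h \<Longrightarrow> a \<star> b \<in> D (g \<otimes> h)"
  and D_unique: "a \<in> A \<Longrightarrow> \<exists>!c. (\<forall>g\<in>carrier G. c g \<in> D g) \<and> (\<forall>g. g \<notin> carrier G \<longrightarrow> c g = 0) \<and>
        finite {g. c g \<noteq> 0} \<and> a = (\<Sum>g | c g \<noteq> 0. c g)"
  using graded unfolding graded_algebra_def graded_space_def incidence_algebra_eq degree_compatible_def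
  by auto

lemmas D_closed [intro] =
  fun_space.subspace_0[OF D_subspace] fun_space.subspace_add[OF D_subspace]
  fun_space.subspace_diff[OF D_subspace] fun_space.subspace_scale[OF D_subspace]
  fun_space.subspace_sum[OF D_subspace]

subsection \<open>Homogeneous components\<close>

text \<open>Total in the degree, with value 0 outside the carrier, so that uniqueness of the
  decomposition becomes an equality of functions.\<close>

definition hcomp :: "('x \<times> 'x \<Rightarrow> 'f) \<Rightarrow> 'g \<Rightarrow> 'x \<times> 'x \<Rightarrow> 'f" where
  "hcomp a = (THE c. (\<forall>g\<in>carrier G. c g \<in> D g) \<and> (\<forall>g. g \<notin> carrier G \<longrightarrow> c g = 0) \<and>
        finite {g. c g \<noteq> 0} \<and> a = (\<Sum>g | c g \<noteq> 0. c g))"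

lemma hcomp_props:
  assumes "a \<in> A"
  shows hcomp_D: "g \<in> carrier G \<Longrightarrow> hcomp a g \<in> D g"
    and hcomp_outside: "g \<notin> carrier G \<Longrightarrow> hcomp a g = 0"
    and hcomp_finite: "finite {g. hcomp a g \<noteq> 0}"
    and hcomp_total: "a = (\<Sum>g | hcomp a g \<noteq> 0. hcomp a g)"
  using theI'[OF D_unique[OF assms]] unfolding hcomp_def[symmetric] by auto

lemma hcomp_A [simp, intro]: "a \<in> A \<Longrightarrow> hcomp a g \<in> A"
  by (cases "g \<in> carrier G") (auto intro: D_in_A hcomp_D simp: hcomp_outside)

text \<open>The finite set \<open>K\<close> may be larger than the support, which allows
  decompositions with different supports to be combined over a common index set.\<close>

lemma hcomp_unique:
  assumes "finite K" "\<And>g. g \<in> carrier G \<Longrightarrow> c g \<in> D g" "\<And>g. g \<notin> carrier G \<Longrightarrow> c g = 0"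
    "\<And>g. g \<notin> K \<Longrightarrow> c g = 0" "a = (\<Sum>g\<in>K. c g)"
  shows "hcomp a = c"
proof -
  have "c g \<in> A" for g
    by (cases "g \<in> carrier G") (auto intro: D_in_A assms simp: assms)
  then have "a \<in> A"
    by (auto simp: assms(5))
  moreover have "{g. c g \<noteq> 0} \<subseteq> K"
    using assms(4) by blast
  then have "a = (\<Sum>g | c g \<noteq> 0. c g)" "finite {g. c g \<noteq> 0}"
    using assms(1) by (auto simp: assms(5) intro!: sum.mono_neutral_right finite_subset[of _ K])
  ultimately show ?thesis
    unfolding hcomp_def using assms D_unique[of a] by (intro the1_equality) auto
qed

lemma hcomp_total':
  assumes "a \<in> A" "finite K" "\<And>g. g \<notin> K \<Longrightarrow> hcomp a g = 0"
  shows "(\<Sum>g\<in>K. hcomp a g) = a"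
  by (subst (2) hcomp_total[OF assms(1)], rule sum.mono_neutral_right) (use assms in auto)

lemma hcomp_add:
  assumes "a \<in> A" "b \<in> A" shows "hcomp (a + b) g = hcomp a g + hcomp b g"
proof -
  define K where "K = {g. hcomp a g \<noteq> 0} \<union> {g. hcomp b g \<noteq> 0}"
  have K: "finite K" using assms hcomp_finite by (auto simp: K_def)
  have "hcomp (a + b) = (\<lambda>g. hcomp a g + hcomp b g)"
    by (rule hcomp_unique[OF K])
      (use assms hcomp_total'[OF assms(1) K] hcomp_total'[OF assms(2) K]
        in \<open>auto simp: K_def hcomp_D hcomp_outside sum.distrib intro!: D_closed\<close>)
  then show ?thesis by simp
qed

lemma hcomp_scale:
  assumes "a \<in> A" shows "hcomp (fscale c a) g = fscale c (hcomp a g)"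
proof -
  have K: "finite {g. hcomp a g \<noteq> 0}" using assms hcomp_finite by auto
  have "hcomp (fscale c a) = (\<lambda>g. fscale c (hcomp a g))"
    by (rule hcomp_unique[OF K])
      (use assms hcomp_total'[OF assms(1) K]
        in \<open>auto simp: hcomp_D hcomp_outside intro!: D_closed simp flip: fun_space.scale_sum_right\<close>)
  then show ?thesis by simp
qed

lemma hcomp_zero [simp]: "hcomp 0 g = 0"
  using hcomp_scale[of 0 0 g] by simp

lemma hcomp_diff:
  assumes "a \<in> A" "b \<in> A" shows "hcomp (a - b) g = hcomp a g - hcomp b g"
  using hcomp_add[of "a - b" b g] assms by (simp add: algebra_simps)

lemma hcomp_sum: "(\<And>i. i \<in> I \<Longrightarrow> f i \<in> A) \<Longrightarrow> hcomp (\<Sum>i\<in>I. f i) g = (\<Sum>i\<in>I. hcomp (f i) g)"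
  by (induction I rule: infinite_finite_induct) (auto simp: hcomp_add)

lemma hcomp_homogeneous:
  assumes "g \<in> carrier G" "a \<in> D g" shows "hcomp a h = (if h = g then a else 0)"
proof -
  have "hcomp a = (\<lambda>h. if h = g then a else 0)"
    by (rule hcomp_unique[of "{g}"]) (use assms in \<open>auto intro!: D_closed\<close>)
  then show ?thesis by simp
qed

text \<open>Since the matrix units span \<open>A\<close>, this finite set contains the degrees of
  all nonzero components of all elements. Sums over degrees run over it.\<close>

definition supp :: "'g set" where
  "supp = (\<Union>b\<in>r. {g. hcomp (E b) g \<noteq> 0})"

lemma finite_supp [simp]: "finite supp"
  by (auto simp: supp_def intro!: hcomp_finite)

lemma hcomp_not_supp:
  assumes "a \<in> A" "g \<notin> supp" shows "hcomp a g = 0"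
proof -
  have "hcomp a g = (\<Sum>b\<in>r. fscale (a b) (hcomp (E b) g))"
    by (subst A_expand[OF assms(1)]) (simp add: hcomp_sum hcomp_scale)
  also have "\<dots> = 0"
    using assms(2) by (auto simp: supp_def)
  finally show ?thesis .
qed

lemma supp_carrier: "supp \<subseteq> carrier G"
  using hcomp_outside E_in_A by (auto simp: supp_def)

lemma hcomp_sum_supp: "a \<in> A \<Longrightarrow> (\<Sum>g\<in>supp. hcomp a g) = a"
  by (rule hcomp_total') (auto simp: hcomp_not_supp)

lemma hcomp_mul:
  assumes "a \<in> A" "b \<in> A"
  shows "hcomp (a \<star> b) k = (\<Sum>g\<in>supp. \<Sum>h\<in>supp. if g \<otimes> h = k then hcomp a g \<star> hcomp b h else 0)"
proof -
  have "hcomp (a \<star> b) k = hcomp ((\<Sum>g\<in>supp. hcomp a g) \<star> (\<Sum>h\<in>supp. hcomp b h)) k"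
    using assms by (simp add: hcomp_sum_supp)
  also have "\<dots> = (\<Sum>g\<in>supp. \<Sum>h\<in>supp. hcomp (hcomp a g \<star> hcomp b h) k)"
    using assms by (subst conv_sum_left, subst hcomp_sum) (auto simp: conv_sum_right hcomp_sum)
  also have "\<dots> = (\<Sum>g\<in>supp. \<Sum>h\<in>supp. if g \<otimes> h = k then hcomp a g \<star> hcomp b h else 0)"
    using assms supp_carrier
    by (intro sum.cong) (auto simp: hcomp_homogeneous[OF m_closed D_mult[OF _ _ hcomp_D hcomp_D]] subset_iff)
  finally show ?thesis .
qed

text \<open>Multiplication by a homogeneous element shifts degrees injectively, so among the
  components of \<open>a\<close> only that of degree \<open>h\<close> reaches degree
  \<open>g \<otimes> h\<close>.\<close>

lemma hcomp_mul_left: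
  assumes g: "g \<in> carrier G" "h \<in> carrier G" and b: "b \<in> D g" and a: "a \<in> A"
  shows "hcomp (b \<star> a) (g \<otimes> h) = b \<star> hcomp a h"
proof -
  have "hcomp (b \<star> a) (g \<otimes> h) = hcomp (\<Sum>k\<in>supp. b \<star> hcomp a k) (g \<otimes> h)"
    using a by (simp add: hcomp_sum_supp flip: conv_sum_right)
  also have "\<dots> = (\<Sum>k\<in>supp. hcomp (b \<star> hcomp a k) (g \<otimes> h))"
    using a b g by (intro hcomp_sum) (auto intro: D_in_A)
  also have "\<dots> = (\<Sum>k\<in>supp. if k = h then b \<star> hcomp a h else 0)"
    using supp_carrier g b a
    by (intro sum.cong) (auto simp: hcomp_homogeneous[OF m_closed D_mult[OF g(1)]] hcomp_D subset_iff)
  also have "\<dots> = b \<star> hcomp a h"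
    using hcomp_not_supp[OF a, of h] by simp
  finally show ?thesis .
qed

lemma hcomp_mul_right:
  assumes g: "g \<in> carrier G" "h \<in> carrier G" and b: "b \<in> D g" and a: "a \<in> A"
  shows "hcomp (a \<star> b) (h \<otimes> g) = hcomp a h \<star> b"
proof -
  have "hcomp (a \<star> b) (h \<otimes> g) = hcomp (\<Sum>k\<in>supp. hcomp a k \<star> b) (h \<otimes> g)"
    using a by (simp add: hcomp_sum_supp flip: conv_sum_left)
  also have "\<dots> = (\<Sum>k\<in>supp. hcomp (hcomp a k \<star> b) (h \<otimes> g))"
    using a b g by (intro hcomp_sum) (auto intro: D_in_A)
  also have "\<dots> = (\<Sum>k\<in>supp. if k = h then hcomp a h \<star> b else 0)"
    using supp_carrier g b a
    by (intro sum.cong) (auto simp: hcomp_homogeneous[OF m_closed D_mult[OF _ g(1)]] hcomp_D subset_iff)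
  also have "\<dots> = hcomp a h \<star> b"
    using hcomp_not_supp[OF a, of h] by simp
  finally show ?thesis .
qed

text \<open>The degree-1 component of \<open>U\<close> is a right unit: for \<open>a\<close> of
  degree \<open>h\<close>, compare the components of degree \<open>h\<close> in
  \<open>a \<star> U = a\<close>, then sum over the degrees. A right unit multiplied by
  \<open>U\<close> on the left equals \<open>U\<close>.\<close>

lemma U_homogeneous: "U \<in> D \<one>"
proof -
  have "hcomp U \<one> = U"
  proof -
    have *: "hcomp a h = a \<star> hcomp U \<one>" if "h \<in> carrier G" "a \<in> D h" for a h
      using hcomp_mul_left[OF that(1) one_closed that(2) U_in_A] that
      by (simp add: hcomp_homogeneous D_in_A)
    have "a \<star> hcomp U \<one> = a" if "a \<in> A" for a
    proof -
      have "a \<star> hcomp U \<one> = (\<Sum>g\<in>supp. hcomp a g \<star> hcomp U \<one>)"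
        using that by (simp add: hcomp_sum_supp flip: conv_sum_left)
      also have "\<dots> = (\<Sum>g\<in>supp. hcomp a g)"
        using supp_carrier that
        by (intro sum.cong) (auto simp: hcomp_homogeneous[OF _ hcomp_D] subset_iff simp flip: *[OF _ hcomp_D])
      finally show ?thesis using that by (simp add: hcomp_sum_supp)
    qed
    from this[of U] show ?thesis by simp
  qed
  then show ?thesis using hcomp_D[OF U_in_A one_closed] by simp
qed

subsection \<open>The Jacobson radical is graded\<close>

definition J :: "('x \<times> 'x \<Rightarrow> 'f) set" where
  "J = {f \<in> A. \<forall>x\<in>X. f (x, x) = 0}"

lemma J_D: "f \<in> J \<Longrightarrow> f \<in> A" "f \<in> J \<Longrightarrow> x \<in> X \<Longrightarrow> f (x, x) = 0"
  by (auto simp: J_def)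

lemma E_mul_left: "x \<in> X \<Longrightarrow> (E (x, x) \<star> f) (p, q) = (if p = x then f (x, q) else 0)"
proof -
  assume x: "x \<in> X"
  have "(E (x, x) \<star> f) (p, q) = (\<Sum>z\<in>X. if z = x then (if p = x then f (x, q) else 0) else 0)"
    by (auto simp: conv_apply matrix_unit_apply intro!: sum.cong)
  then show ?thesis using x finite_X by simp
qed

lemma E_mul_right: "x \<in> X \<Longrightarrow> (f \<star> E (x, x)) (p, q) = (if q = x then f (p, x) else 0)"
proof -
  assume x: "x \<in> X"
  have "(f \<star> E (x, x)) (p, q) = (\<Sum>z\<in>X. if z = x then (if q = x then f (p, x) else 0) else 0)"
    by (auto simp: conv_apply matrix_unit_apply intro!: sum.cong)
  then show ?thesis using x finite_X by simp
qed

text \<open>This is the diagonal entry at \<open>E (x, y)\<close> of the matrix of left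
  multiplication by \<open>a\<close> in the basis of matrix units, as its trace requires.\<close>

lemma mul_E_diag:
  assumes "(x, y) \<in> r" shows "(a \<star> E (x, y)) (x, y) = a (x, x)"
proof -
  have "(a \<star> E (x, y)) (x, y) = (\<Sum>z\<in>X. if z = x then a (x, x) else 0)"
    by (auto simp: conv_apply matrix_unit_apply intro!: sum.cong)
  then show ?thesis using assms r_subset finite_X by auto
qed

lemma diag_hcomp_mul:
  assumes "a \<in> A" "b \<in> A" "x \<in> X"
  shows "hcomp (a \<star> b) k (x, x) =
    (\<Sum>g\<in>supp. \<Sum>h\<in>supp. if g \<otimes> h = k then hcomp a g (x, x) * hcomp b h (x, x) else 0)"
  unfolding hcomp_mul[OF assms(1,2)] fun_sum_apply
  by (intro sum.cong refl) (use assms in auto)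

text \<open>Diagonal values are scalars, and in an abelian group the condition
  \<open>g \<otimes> h = k\<close> is symmetric, so both products yield the same double sum.\<close>

lemma diag_hcomp_commutator:
  assumes "comm_group G" and ab: "a \<in> A" "b \<in> A" and x: "x \<in> X"
  shows "hcomp (a \<star> b - b \<star> a) k (x, x) = 0"
proof -
  interpret comm_group G by fact
  have "hcomp (b \<star> a) k (x, x) =
    (\<Sum>g\<in>supp. \<Sum>h\<in>supp. if h \<otimes> g = k then hcomp b h (x, x) * hcomp a g (x, x) else 0)"
    unfolding diag_hcomp_mul[OF ab(2,1) x] by (rule sum.swap)
  also have "\<dots> = hcomp (a \<star> b) k (x, x)"
    unfolding diag_hcomp_mul[OF ab x] using supp_carrier
    by (intro sum.cong refl) (auto simp: m_comm subset_iff mult.commute)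
  finally show ?thesis using ab by (simp add: hcomp_diff)
qed

text \<open>The off-diagonal matrix units span \<open>J\<close>, so every element of
  \<open>J\<close> is a combination of commutators.\<close>

lemma E_commutator:
  assumes "(x, y) \<in> r" "x \<noteq> y"
  shows "E (x, y) = E (x, x) \<star> E (x, y) - E (x, y) \<star> E (x, x)"
  using assms r_subset by (auto simp: fun_eq_iff E_mul_left E_mul_right matrix_unit_apply)

lemma J_graded_comm:
  assumes "comm_group G" "a \<in> J"
  shows "hcomp a g \<in> J"
proof -
  have aA: "a \<in> A" using assms J_D by blast
  have "hcomp a g (x, x) = 0" if x: "x \<in> X" for x
  proof -
    have "hcomp a g (x, x) = (\<Sum>b\<in>r. a b * hcomp (E b) g (x, x))"
      by (subst A_expand[OF aA]) (simp add: hcomp_sum hcomp_scale fun_sum_apply)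
    also have "\<dots> = 0"
    proof (rule sum.neutral, clarify)
      fix y z assume yz: "(y, z) \<in> r"
      show "a (y, z) * hcomp (E (y, z)) g (x, x) = 0"
      proof (cases "y = z")
        case True then show ?thesis using J_D(2)[OF assms(2), of y] yz r_subset by auto
      next
        case False
        then show ?thesis
          by (subst E_commutator[OF yz])
            (use diag_hcomp_commutator[OF assms(1) _ _ x] yz r_subset r_refl in auto)
      qed
    qed
    finally show ?thesis .
  qed
  then show ?thesis using aA by (simp add: J_def)
qed

section \<open>The trace argument for the radical\<close>

definition linear_on_A :: "(('x \<times> 'x \<Rightarrow> 'f) \<Rightarrow> 'x \<times> 'x \<Rightarrow> 'f) \<Rightarrow> bool" where
  "linear_on_A L \<longleftrightarrow> (\<forall>f\<in>A. L f \<in> A \<and> L f = (\<Sum>b\<in>r. fscale (f b) (L (E b))))"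

lemma linear_on_A_D:
  assumes "linear_on_A L" "f \<in> A"
  shows "L f \<in> A" "L f = (\<Sum>b\<in>r. fscale (f b) (L (E b)))"
  using assms unfolding linear_on_A_def by blast+

definition trace :: "(('x \<times> 'x \<Rightarrow> 'f) \<Rightarrow> 'x \<times> 'x \<Rightarrow> 'f) \<Rightarrow> 'f" where
  "trace L = (\<Sum>b\<in>r. L (E b) b)"

text \<open>Both sides expand to the same double sum of products of matrix entries.\<close>

lemma trace_commute:
  assumes "linear_on_A L" "linear_on_A M"
  shows "trace (\<lambda>v. L (M v)) = trace (\<lambda>v. M (L v))"
proof -
  have *: "trace (\<lambda>v. L (M v)) = (\<Sum>b\<in>r. \<Sum>c\<in>r. M (E b) c * L (E c) b)"
    if "linear_on_A L" "linear_on_A M" for L M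
  proof -
    have "L (M (E b)) b = (\<Sum>c\<in>r. M (E b) c * L (E c) b)" if "b \<in> r" for b
    proof -
      have "M (E b) \<in> A"
        by (rule linear_on_A_D(1)[OF \<open>linear_on_A M\<close> E_in_A[OF that]])
      then have "L (M (E b)) = (\<Sum>c\<in>r. fscale (M (E b) c) (L (E c)))"
        by (rule linear_on_A_D(2)[OF \<open>linear_on_A L\<close>])
      then have "L (M (E b)) b = (\<Sum>c\<in>r. fscale (M (E b) c) (L (E c))) b" by simp
      then show ?thesis by (simp only: fun_sum_apply fscale_apply)
    qed
    then show ?thesis by (simp add: trace_def)
  qed
  show ?thesis
    unfolding *[OF assms] *[OF assms(2,1)] by (subst sum.swap) (simp add: mult.commute)
qed

lemma linear_hcomp: "linear_on_A (\<lambda>v. hcomp v h)"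
  unfolding linear_on_A_def
proof (intro ballI conjI)
  fix f assume f: "f \<in> A"
  show "hcomp f h = (\<Sum>b\<in>r. fscale (f b) (hcomp (E b) h))"
    by (subst A_expand[OF f]) (simp add: hcomp_sum hcomp_scale)
qed simp

lemma linear_mul_hcomp: "a \<in> A \<Longrightarrow> linear_on_A (\<lambda>v. a \<star> hcomp v h)"
  unfolding linear_on_A_def
proof (intro ballI conjI)
  fix f assume f: "f \<in> A"
  have "a \<star> hcomp f h = a \<star> (\<Sum>b\<in>r. fscale (f b) (hcomp (E b) h))"
    by (rule arg_cong[OF linear_on_A_D(2)[OF linear_hcomp f]])
  then show "a \<star> hcomp f h = (\<Sum>b\<in>r. fscale (f b) (a \<star> hcomp (E b) h))"
    by (simp add: conv_sum_right conv_scale_right)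
qed auto

text \<open>The trace of left multiplication by \<open>a\<close> on \<open>A\<close>.\<close>

definition \<tau> :: "('x \<times> 'x \<Rightarrow> 'f) \<Rightarrow> 'f" where
  "\<tau> a = (\<Sum>(x, y)\<in>r. a (x, x))"

lemma \<tau>_trace: "\<tau> a = trace (\<lambda>v. a \<star> v)"
  by (auto simp: \<tau>_def trace_def mul_E_diag intro!: sum.cong)

lemma \<tau>_sum: "\<tau> (\<Sum>i\<in>I. f i) = (\<Sum>i\<in>I. \<tau> (f i))"
  unfolding \<tau>_def fun_sum_apply case_prod_unfold by (rule sum.swap)

text \<open>For each \<open>h\<close>, the trace of \<open>v \<mapsto> a \<star> hcomp v h\<close>
  is 0: the projection to degree \<open>h\<close> is idempotent, and one copy of it can be moved to
  the left inside the trace, where it kills \<open>a \<star> hcomp v h\<close>, of degree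
  \<open>g \<otimes> h \<noteq> h\<close>. Summing over \<open>h\<close> gives the claim.\<close>

lemma \<tau>_homogeneous:
  assumes g: "g \<in> carrier G" "g \<noteq> \<one>" and a: "a \<in> D g"
  shows "\<tau> a = 0"
proof -
  have aA: "a \<in> A" using D_in_A g a by blast
  have zero: "trace (\<lambda>v. a \<star> hcomp v h) = 0" if h: "h \<in> supp" for h
  proof -
    have hc: "h \<in> carrier G" using h supp_carrier by blast
    have "trace (\<lambda>v. hcomp (a \<star> hcomp v h) h) = 0"
      unfolding trace_def
    proof (rule sum.neutral, rule ballI)
      fix b assume "b \<in> r"
      then have "a \<star> hcomp (E b) h \<in> D (g \<otimes> h)"
        using g a hc by (intro D_mult hcomp_D) auto
      moreover have "h \<noteq> g \<otimes> h" using g hc by (metis l_one one_closed right_cancel)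
      ultimately show "hcomp (a \<star> hcomp (E b) h) h b = 0"
        using g hc by (subst hcomp_homogeneous[of "g \<otimes> h"]) auto
    qed
    then have "trace (\<lambda>v. a \<star> hcomp (hcomp v h) h) = 0"
      using trace_commute[OF linear_mul_hcomp[OF aA, of h] linear_hcomp[of h]] by simp
    then show ?thesis
      using hc by (simp add: trace_def hcomp_homogeneous[OF hc hcomp_D])
  qed
  have "\<tau> a = (\<Sum>b\<in>r. (a \<star> (\<Sum>h\<in>supp. hcomp (E b) h)) b)"
    by (simp add: \<tau>_trace trace_def hcomp_sum_supp)
  also have "\<dots> = (\<Sum>b\<in>r. \<Sum>h\<in>supp. (a \<star> hcomp (E b) h) b)"
    unfolding conv_sum_right fun_sum_apply ..
  also have "\<dots> = (\<Sum>h\<in>supp. trace (\<lambda>v. a \<star> hcomp v h))"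
    unfolding trace_def by (rule sum.swap)
  also have "\<dots> = 0" using zero by simp
  finally show ?thesis .
qed

text \<open>Let \<open>w\<close> and \<open>b\<close> be the components of \<open>a\<close> in
  degree \<open>g\<close> and of \<open>E (x, x)\<close> in degree \<open>inv g\<close>. As \<tau>
  sees only degree 1, it has the same value at \<open>w \<star> E (x, x)\<close>,
  \<open>w \<star> b\<close> and \<open>a \<star> b\<close>. The last has zero diagonal, while the
  first gives \<open>w (x, x)\<close> times the number of points above \<open>x\<close>.\<close>

lemma J_graded_trace:
  assumes char: "\<And>x. x \<in> X \<Longrightarrow> of_nat (card {y. (x, y) \<in> r}) \<noteq> (0::'f)" and a: "a \<in> J"
  shows "hcomp a g \<in> J"
proof (cases "g \<in> carrier G")
  case False
  then show ?thesis using J_D(1)[OF a] by (simp add: hcomp_outside J_def)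
next
  case g: True
  have aA: "a \<in> A" using a J_D by blast
  have ig: "inv g \<in> carrier G" using g by simp
  have "hcomp a g (x, x) = 0" if x: "x \<in> X" for x
  proof -
    define w where "w = hcomp a g"
    have w: "w \<in> D g" "w \<in> A" using g aA by (auto simp: w_def hcomp_D)
    have Ex: "E (x, x) \<in> A" using x r_refl by simp
    define b where "b = hcomp (E (x, x)) (inv g)"
    have b: "b \<in> D (inv g)" "b \<in> A" using ig Ex by (auto simp: b_def hcomp_D)
    have "\<tau> (w \<star> E (x, x)) = \<tau> (\<Sum>h\<in>supp. w \<star> hcomp (E (x, x)) h)"
      using Ex by (simp add: hcomp_sum_supp flip: conv_sum_right)
    also have "\<dots> = (\<Sum>h\<in>supp. if h = inv g then \<tau> (w \<star> b) else 0)"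
      unfolding \<tau>_sum
    proof (rule sum.cong)
      fix h assume "h \<in> supp"
      then have h: "h \<in> carrier G" using supp_carrier by blast
      show "\<tau> (w \<star> hcomp (E (x, x)) h) = (if h = inv g then \<tau> (w \<star> b) else 0)"
      proof (cases "h = inv g")
        case False
        then have "g \<otimes> h \<noteq> \<one>" using g h inv_equality inv_comm by metis
        then show ?thesis using False g h w Ex
          by (auto intro!: \<tau>_homogeneous[of "g \<otimes> h"] D_mult hcomp_D)
      qed (simp add: b_def)
    qed simp
    \<comment> \<open>If \<open>inv g\<close> is outside \<open>supp\<close>, then \<open>b\<close>
      is 0 and the sum, having only zero terms, is still correct.\<close>
    also have "\<dots> = \<tau> (w \<star> b)"
      using hcomp_not_supp[OF Ex, of "inv g"] by (auto simp: b_def \<tau>_def)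
    also have "\<dots> = (\<Sum>h\<in>supp. if h = g then \<tau> (w \<star> b) else 0)"
      using hcomp_not_supp[OF aA, of g] by (auto simp: w_def \<tau>_def)
    also have "\<dots> = (\<Sum>h\<in>supp. \<tau> (hcomp a h \<star> b))"
    proof (rule sum.cong)
      fix h assume "h \<in> supp"
      then have h: "h \<in> carrier G" using supp_carrier by blast
      show "(if h = g then \<tau> (w \<star> b) else 0) = \<tau> (hcomp a h \<star> b)"
      proof (cases "h = g")
        case False
        then have "h \<otimes> inv g \<noteq> \<one>" using g h inv_solve_right' by force
        then show ?thesis using False ig h b aA
          by (auto intro!: \<tau>_homogeneous[of "h \<otimes> inv g"] D_mult hcomp_D)
      qed (simp add: w_def)
    qed simp
    also have "\<dots> = \<tau> (a \<star> b)"
      using aA by (simp add: hcomp_sum_supp flip: \<tau>_sum conv_sum_left)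
    also have "\<dots> = 0"
      unfolding \<tau>_def using r_subset aA b J_D(2)[OF a] by (auto intro!: sum.neutral)
    finally have zero: "\<tau> (w \<star> E (x, x)) = 0" .
    \<comment> \<open>Only column \<open>x\<close> survives the multiplication; its diagonal value
      is counted once for each \<open>y\<close> above \<open>x\<close>.\<close>
    have "\<tau> (w \<star> E (x, x)) = (\<Sum>(p, y)\<in>r. if p = x then w (x, x) else 0)"
      unfolding \<tau>_def using x by (auto simp: E_mul_right intro!: sum.cong)
    also have "\<dots> = (\<Sum>(p, y)\<in>{x} \<times> {y. (x, y) \<in> r}. w (x, x))"
      by (rule sum.mono_neutral_cong_right) (auto split: if_splits)
    also have "\<dots> = of_nat (card {y. (x, y) \<in> r}) * w (x, x)"
      by (simp add: card_cartesian_product case_prod_unfold)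
    finally show ?thesis using char[OF x] zero by (simp add: w_def)
  qed
  then show ?thesis using aA by (simp add: J_def)
qed

text \<open>The matrix units form a basis. This turns the bound on the characteristic into one by
  the number of related pairs.\<close>

lemma card_r_eq_dim: "fun_space.dim A = card r"
proof -
  have inj: "inj_on (E :: 'x \<times> 'x \<Rightarrow> 'x \<times> 'x \<Rightarrow> 'f) r"
    by (rule inj_onI) (metis matrix_unit_apply zero_neq_one)
  have indep: "fun_space.independent (E ` r)"
  proof (rule fun_space.independent_if_scalars_zero)
    fix c and v :: "'x \<times> 'x \<Rightarrow> 'f"
    assume sum: "(\<Sum>v\<in>E ` r. fscale (c v) v) = 0" and "v \<in> E ` r"
    then obtain b where b: "b \<in> r" "v = E b" by blast
    have "(\<Sum>q\<in>r. fscale (c (E q)) (E q)) = 0"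
      using sum by (simp add: sum.reindex[OF inj])
    then have "(\<Sum>q\<in>r. fscale (c (E q)) (E q)) b = 0" by simp
    then have "(\<Sum>q\<in>r. c (E q) * E q b) = 0" by (simp only: fun_sum_apply fscale_apply)
    moreover have "(\<Sum>q\<in>r. c (E q) * E q b) = (\<Sum>q\<in>r. if q = b then c (E b) else 0)"
      by (rule sum.cong) (auto simp: matrix_unit_apply)
    ultimately show "c v = 0" using b by simp
  qed simp
  have "f \<in> fun_space.span (E ` r)" if "f \<in> A" for f
    by (subst A_expand[OF that], intro fun_space.span_sum fun_space.span_scale fun_space.span_base) simp
  then have "A \<subseteq> fun_space.span (E ` r)" by blast
  moreover have "E ` r \<subseteq> A" by auto
  ultimately have "card (E ` r :: ('x \<times> 'x \<Rightarrow> 'f) set) = fun_space.dim A"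
    using indep by (intro fun_space.basis_card_eq_dim)
  then show ?thesis by (simp add: card_image[OF inj])
qed

lemma J_graded:
  assumes "CHAR('f) = 0 \<or> CHAR('f) > fun_space.dim A \<or> comm_group G" "a \<in> J"
  shows "hcomp a g \<in> J"
proof (cases "comm_group G")
  case True
  then show ?thesis using J_graded_comm assms by blast
next
  case False
  \<comment> \<open>The weight of \<open>x\<close> is at least 1 and at most \<open>card r\<close>,
    so a characteristic that is 0 or exceeds the dimension does not divide it.\<close>
  have "of_nat (card {y. (x, y) \<in> r}) \<noteq> (0::'f)" if x: "x \<in> X" for x
  proof -
    have fin: "finite {y. (x, y) \<in> r}"
      by (rule finite_subset[of _ X]) (use r_subset finite_X in auto)
    have "card {y. (x, y) \<in> r} = card (Pair x ` {y. (x, y) \<in> r})"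
      by (rule card_image[symmetric]) (auto simp: inj_on_def)
    also have "\<dots> \<le> card r"
      by (rule card_mono) auto
    finally have "card {y. (x, y) \<in> r} \<le> card r" .
    moreover have "card {y. (x, y) \<in> r} > 0"
      using fin r_refl[OF x] by (auto simp: card_gt_0_iff)
    ultimately show ?thesis
      using assms(1) False by (auto simp: of_nat_eq_0_iff_char_dvd card_r_eq_dim dest: dvd_imp_le)
  qed
  then show ?thesis using J_graded_trace assms(2) by blast
qed

end

section \<open>Roots of unity\<close>

lemma power_gcd_eq_1:
  fixes z :: "'f::field"
  assumes "z ^ m = 1" "z ^ n = 1" "m > 0"
  shows "z ^ gcd m n = 1"
proof -
  obtain x y where "m * x = n * y + gcd m n"
    using bezout_nat[of m n] assms(3) by auto
  then have "z ^ (m * x) = z ^ (n * y) * z ^ gcd m n"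
    by (simp add: power_add)
  then show ?thesis using assms by (simp add: power_mult)
qed

text \<open>For a prime \<open>p\<close> with exact power \<open>p ^ k p\<close> in
  \<open>N\<close>, the power \<open>\<zeta> p\<close> of the witness \<open>w p\<close> has order
  exactly \<open>p ^ k p\<close>. The product of these elements of coprime orders has order
  \<open>N\<close>.\<close>

lemma primitive_root_exists:
  assumes N: "N > 0"
    and w: "\<And>p. prime p \<Longrightarrow> p dvd N \<Longrightarrow> \<exists>w :: 'f::field. w ^ N = 1 \<and> w ^ (N div p) \<noteq> 1"
  shows "\<exists>z :: 'f. primitive_root_of_unity N z"
proof -
  obtain w :: "nat \<Rightarrow> 'f" where w: "\<And>p. p \<in> prime_factors N \<Longrightarrow> w p ^ N = 1 \<and> w p ^ (N div p) \<noteq> 1"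
    using w by (metis in_prime_factors_iff)
  define k where "k p = multiplicity p N" for p
  define \<zeta> where "\<zeta> p = w p ^ (N div p ^ k p)" for p
  define z where "z = (\<Prod>p\<in>prime_factors N. \<zeta> p)"
  have dvd: "p ^ k p dvd N" for p by (simp add: k_def multiplicity_dvd)
  have \<zeta>1: "\<zeta> p ^ (p ^ k p) = 1" if "p \<in> prime_factors N" for p
    using w[OF that] dvd[of p] by (simp add: \<zeta>_def flip: power_mult)
  have \<zeta>2: "\<zeta> p ^ m = 1" if "p \<in> prime_factors N" "p ^ k p dvd m" for p m
    using \<zeta>1[OF that(1)] that(2) by (auto simp: power_mult elim!: dvdE)
  have zN: "z ^ N = 1"
    unfolding z_def prod_power_distrib using \<zeta>2 dvd by (intro prod.neutral) blast
  have zp: "z ^ (N div p) \<noteq> 1" if p: "p \<in> prime_factors N" for p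
  proof
    assume 1: "z ^ (N div p) = 1"
    have pp: "prime p" "p dvd N" using p by (auto simp: in_prime_factors_iff)
    obtain m where m: "N = p ^ k p * m" "\<not> p dvd m"
      unfolding k_def
    proof (rule multiplicity_decompose')
      show "N \<noteq> 0" "\<not> is_unit p" using N pp(1) not_prime_unit by auto
    qed
    obtain k' where k': "k p = Suc k'"
      using pp N by (metis k_def not0_implies_Suc not_dvd_imp_multiplicity_0 multiplicity_eq_zero_iff
          nat_neq_iff not_prime_unit prime_nat_iff)
    have Np: "N div p = p ^ k' * m"
      using m(1) k' pp(1) by (simp add: prime_gt_0_nat mult.assoc)
    \<comment> \<open>The full power of each other prime still divides \<open>N div p\<close>, so
      only the factor \<open>\<zeta> p\<close> remains to be tested.\<close>
    have "\<zeta> q ^ (N div p) = 1" if q: "q \<in> prime_factors N" "q \<noteq> p" for q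
    proof (rule \<zeta>2[OF q(1)])
      have "coprime (q ^ k q) p"
        using q pp by (simp add: in_prime_factors_iff primes_coprime)
      moreover have "q ^ k q dvd p * (N div p)" using dvd[of q] pp by simp
      ultimately show "q ^ k q dvd N div p" by (simp add: coprime_dvd_mult_right_iff)
    qed
    then have "z ^ (N div p) = \<zeta> p ^ (N div p)"
      unfolding z_def prod_power_distrib using p by (subst prod.remove[of _ p]) auto
    then have "\<zeta> p ^ gcd (p ^ k p) (N div p) = 1"
      using 1 \<zeta>1[OF p] pp(1) by (intro power_gcd_eq_1) (auto simp: prime_gt_0_nat)
    \<comment> \<open>Here \<open>k'\<close> is \<open>k p - 1\<close>, and \<open>\<zeta> p\<close>
      to the power \<open>p ^ k'\<close> is the given nontrivial value
      \<open>w p ^ (N div p)\<close>.\<close>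
    moreover have "gcd (p ^ k p) (N div p) = p ^ k'"
    proof -
      have "coprime p m" using m(2) pp(1) by (simp add: prime_imp_coprime)
      then have "gcd (p ^ k' * p) (p ^ k' * m) = p ^ k'"
        by (simp add: gcd_mult_distrib_nat[symmetric])
      then show ?thesis by (simp add: Np k' mult.commute)
    qed
    ultimately have "w p ^ (N div p ^ k p * p ^ k') = 1"
      by (simp add: \<zeta>_def power_mult)
    moreover have "N div p ^ k p = m"
      using m(1) N by (metis mult_eq_0_iff neq0_conv nonzero_mult_div_cancel_left)
    then have "N div p ^ k p * p ^ k' = N div p"
      by (simp add: Np mult.commute)
    ultimately show False using w[OF p] by simp
  qed
  \<comment> \<open>An exponent \<open>j\<close> can be replaced by its gcd with \<open>N\<close>, a
    proper divisor of \<open>N\<close>, which divides \<open>N div p\<close> for some prime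
    \<open>p\<close>.\<close>
  have "z ^ j \<noteq> 1" if j: "0 < j" "j < N" for j
  proof
    assume "z ^ j = 1"
    then have d: "z ^ gcd j N = 1" using power_gcd_eq_1[OF _ zN j(1)] by blast
    obtain m where m: "N = gcd j N * m" by (meson dvdE gcd_dvd2)
    have "gcd j N < N" using j gcd_le1_nat[of j N] by linarith
    then have "m \<noteq> 1" using m by auto
    then obtain p where p: "prime p" "p dvd m" using prime_factor_nat by blast
    then obtain m' where m': "m = p * m'" by blast
    have "N div p = gcd j N * m'"
      by (subst m) (use p in \<open>simp add: m' prime_gt_0_nat\<close>)
    then have "z ^ (N div p) = 1" using d by (simp add: power_mult)
    moreover have "p \<in> prime_factors N"
      using p m N by (metis dvd_mult in_prime_factors_iff neq0_conv)
    ultimately show False using zp by blast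
  qed
  then show ?thesis using N zN by (auto simp: primitive_root_of_unity_def)
qed

section \<open>Blocks and their support groups\<close>

locale radical_graded = graded_incidence G X r D
  for G :: "('g, 'h) monoid_scheme" (structure)
    and X :: "'x set" and r :: "('x \<times> 'x) set"
    and D :: "'g \<Rightarrow> ('x \<times> 'x \<Rightarrow> 'f::field) set" +
  assumes J_graded: "a \<in> J \<Longrightarrow> hcomp a g \<in> J"
begin

definition block :: "'x \<Rightarrow> 'x set" where
  "block x = {y \<in> X. \<forall>c\<in>D \<one>. c (y, y) = c (x, x)}"

text \<open>The support of the grading induced on the block of \<open>x\<close> modulo
  \<open>J\<close>; by \<open>nonzero_block\<close> every point of the block yields the same
  set.\<close>

definition H :: "'x \<Rightarrow> 'g set" where
  "H x = {g \<in> carrier G. \<exists>c\<in>D g. c (x, x) \<noteq> 0}"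

primrec conv_power :: "('x \<times> 'x \<Rightarrow> 'f) \<Rightarrow> nat \<Rightarrow> 'x \<times> 'x \<Rightarrow> 'f" where
  "conv_power c 0 = U"
| "conv_power c (Suc n) = conv_power c n \<star> c"

lemma conv_power_D: "g \<in> carrier G \<Longrightarrow> c \<in> D g \<Longrightarrow> conv_power c n \<in> D (g [^] n)"
  by (induction n) (auto simp: U_homogeneous intro: D_mult)

lemma conv_power_A [simp]: "c \<in> A \<Longrightarrow> conv_power c n \<in> A"
  by (induction n) auto

lemma conv_power_diag [simp]: "c \<in> A \<Longrightarrow> x \<in> X \<Longrightarrow> conv_power c n (x, x) = c (x, x) ^ n"
  by (induction n) auto

lemma D_in_supp:
  assumes "g \<in> carrier G" "c \<in> D g" "c (x, x) \<noteq> 0" shows "g \<in> supp"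
proof (rule ccontr)
  assume "g \<notin> supp"
  then have "hcomp c g = 0" using assms hcomp_not_supp D_in_A by blast
  then show False using assms by (simp add: hcomp_homogeneous)
qed

lemma H_subset_supp: "H x \<subseteq> supp"
  using D_in_supp by (auto simp: H_def)

lemma finite_H [simp]: "finite (H x)"
  using H_subset_supp finite_supp finite_subset by blast

text \<open>The powers of \<open>c\<close> do not vanish at \<open>x\<close>, so all powers of
  \<open>g\<close> lie in the finite set \<open>supp\<close> and two of them coincide.\<close>

lemma finite_order:
  assumes g: "g \<in> carrier G" and c: "c \<in> D g" "c (x, x) \<noteq> 0" and x: "x \<in> X"
  obtains n :: nat where "n > 0" "g [^] n = \<one>"
proof -
  have cA: "c \<in> A" using g c D_in_A by blast
  have "g [^] n \<in> supp" for n :: nat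
    by (rule D_in_supp[OF _ conv_power_D[OF g c(1)], of _ x]) (use g c x cA in auto)
  then have "range (\<lambda>n::nat. g [^] n) \<subseteq> supp" by blast
  then have "\<not> inj (\<lambda>n::nat. g [^] n)"
    using finite_supp by (metis finite_imageD finite_subset infinite_UNIV_nat)
  then obtain m n :: nat where "m < n" "g [^] m = g [^] n"
    unfolding inj_def by (metis linorder_neqE_nat)
  then have "g [^] (n - m) = \<one>"
    using g pow_eq_div2[of g n m] by simp
  then show thesis using that[of "n - m"] \<open>m < n\<close> by simp
qed

lemma block_refl: "x \<in> X \<Longrightarrow> x \<in> block x"
  by (simp add: block_def)

lemma block_X: "block x \<subseteq> X"
  by (auto simp: block_def)

lemma finite_block [simp]: "finite (block x)"
  using finite_X block_X finite_subset by blast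

lemma block_sym: "x \<in> X \<Longrightarrow> y \<in> block x \<Longrightarrow> x \<in> block y"
  by (auto simp: block_def)

lemma block_eq: "x \<in> X \<Longrightarrow> y \<in> block x \<Longrightarrow> block y = block x"
  by (auto simp: block_def)

lemma block_one: "c \<in> D \<one> \<Longrightarrow> y \<in> block x \<Longrightarrow> c (y, y) = c (x, x)"
  by (auto simp: block_def)

text \<open>Some positive power of \<open>c\<close> has degree 1 and hence is constant on the block,
  so the values of \<open>c\<close> at \<open>x\<close> and \<open>y\<close> agree after raising to
  that power.\<close>

lemma nonzero_block:
  assumes g: "g \<in> carrier G" and c: "c \<in> D g" "c (x, x) \<noteq> 0" and x: "x \<in> X" and y: "y \<in> block x"
  shows "c (y, y) \<noteq> 0"
proof -
  have cA: "c \<in> A" using g c D_in_A by blast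
  obtain n :: nat where n: "n > 0" "g [^] n = \<one>"
    using finite_order[OF g c x] .
  have "conv_power c n \<in> D \<one>" using conv_power_D[OF g c(1), of n] n by simp
  then have "conv_power c n (y, y) = conv_power c n (x, x)" using y block_one by blast
  moreover have "y \<in> X" using y block_X by blast
  ultimately have "c (y, y) ^ n = c (x, x) ^ n" using cA x by simp
  then show ?thesis using c n by (metis power_eq_0_iff)
qed

lemma zero_block:
  assumes "g \<in> carrier G" "c \<in> D g" "c (x, x) = 0" "x \<in> X" "y \<in> block x"
  shows "c (y, y) = 0"
  using nonzero_block[OF assms(1,2), of y x] assms block_sym block_X by blast

section \<open>The support of a block is a finite abelian group\<close>

lemma one_in_H: "x \<in> X \<Longrightarrow> \<one> \<in> H x"
  using U_homogeneous by (auto simp: H_def intro!: bexI[of _ U])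

lemma H_subgroup:
  assumes x: "x \<in> X" shows "subgroup (H x) G"
proof (rule subgroupI)
  show "H x \<subseteq> carrier G" by (auto simp: H_def)
  show "H x \<noteq> {}" using one_in_H[OF x] by blast
next
  fix g assume "g \<in> H x"
  then obtain c where g: "g \<in> carrier G" and c: "c \<in> D g" "c (x, x) \<noteq> 0" by (auto simp: H_def)
  have cA: "c \<in> A" using g c D_in_A by blast
  obtain n :: nat where n: "n > 0" "g [^] n = \<one>"
    using finite_order[OF g c x] .
  \<comment> \<open>Finite order makes the inverse a power of \<open>g\<close>, which the
    corresponding power of \<open>c\<close> represents.\<close>
  then have "g [^] (n - 1) \<otimes> g = \<one>"
    by (metis Suc_diff_1 nat_pow_Suc)
  then have "inv g = g [^] (n - 1)" using g by (simp add: inv_equality)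
  then have "conv_power c (n - 1) \<in> D (inv g)" using conv_power_D[OF g c(1)] by simp
  then show "inv g \<in> H x" using g c cA x by (auto simp: H_def intro!: bexI[of _ "conv_power c (n - 1)"])
next
  fix g h assume "g \<in> H x" "h \<in> H x"
  then obtain c d where g: "g \<in> carrier G" "h \<in> carrier G" and c: "c \<in> D g" "c (x, x) \<noteq> 0"
    and d: "d \<in> D h" "d (x, x) \<noteq> 0" by (auto simp: H_def)
  then show "g \<otimes> h \<in> H x" using x D_in_A by (auto simp: H_def intro!: bexI[of _ "c \<star> d"] D_mult)
qed

text \<open>The commutator of \<open>c\<close> and \<open>d\<close> lies in \<open>J\<close>. If the
  two degrees differed, its component of degree \<open>g \<otimes> h\<close> would be
  \<open>c \<star> d\<close>, which would then lie in \<open>J\<close> although it is nonzero at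
  \<open>x\<close>.\<close>

lemma H_commute:
  assumes x: "x \<in> X" and gh: "g \<in> H x" "h \<in> H x" shows "g \<otimes> h = h \<otimes> g"
proof (rule ccontr)
  assume ne: "g \<otimes> h \<noteq> h \<otimes> g"
  obtain c d where g: "g \<in> carrier G" "h \<in> carrier G" and c: "c \<in> D g" "c (x, x) \<noteq> 0"
    and d: "d \<in> D h" "d (x, x) \<noteq> 0" using gh by (auto simp: H_def)
  have A: "c \<in> A" "d \<in> A" using g c d D_in_A by blast+
  have cd: "c \<star> d \<in> D (g \<otimes> h)" "d \<star> c \<in> D (h \<otimes> g)" using g c d by (auto intro: D_mult)
  have "c \<star> d - d \<star> c \<in> J" using A by (auto simp: J_def)
  then have "hcomp (c \<star> d - d \<star> c) (g \<otimes> h) \<in> J" by (rule J_graded)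
  then have "c \<star> d \<in> J" using cd A g ne
    by (simp add: hcomp_diff hcomp_homogeneous[OF _ cd(1)] hcomp_homogeneous[OF _ cd(2)])
  then show False using c d A x by (auto simp: J_def)
qed

lemma H_comm_group:
  assumes x: "x \<in> X" shows "comm_group (G\<lparr>carrier := H x\<rparr>)"
proof -
  interpret S: group "G\<lparr>carrier := H x\<rparr>"
    using H_subgroup[OF x] subgroup_imp_group by blast
  show ?thesis by unfold_locales (auto intro: H_commute[OF x])
qed

lemma H_normalized:
  assumes x: "x \<in> X" and g: "g \<in> H x"
  obtains v where "v \<in> D g" "v \<in> A" "v (x, x) = 1"
proof -
  obtain c where gc: "g \<in> carrier G" and c: "c \<in> D g" "c (x, x) \<noteq> 0" using g by (auto simp: H_def)
  have "fscale (1 / c (x, x)) c \<in> D g" using gc c by (auto intro: D_closed)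
  then show thesis using that[of "fscale (1 / c (x, x)) c"] c D_in_A gc by auto
qed

text \<open>Multiplying \<open>E (x, x)\<close> by an element of degree \<open>k \<in> H x\<close> with value \<open>1\<close> at \<open>x\<close> only changes
  it by an element of \<open>J\<close>. Hence all its components of degree in \<open>H x\<close> have the same value at \<open>x\<close>.\<close>

lemma card_H_unit:
  assumes x: "x \<in> X"
  shows "of_nat (card (H x)) * hcomp (E (x, x)) \<one> (x, x) = (1::'f)"
proof -
  have Ex: "E (x, x) \<in> A" using x r_refl by simp
  have eq: "hcomp (E (x, x)) k (x, x) = hcomp (E (x, x)) \<one> (x, x)" if k: "k \<in> H x" for k
  proof -
    have kc: "k \<in> carrier G" using k by (simp add: H_def)
    obtain v where v: "v \<in> D k" "v \<in> A" "v (x, x) = 1" using H_normalized[OF x k] .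
    have "v \<star> E (x, x) - E (x, x) \<in> J"
      using v Ex by (auto simp: J_def) (auto simp: matrix_unit_apply)
    then have "hcomp (v \<star> E (x, x) - E (x, x)) k \<in> J" by (rule J_graded)
    moreover have "hcomp (v \<star> E (x, x) - E (x, x)) k = v \<star> hcomp (E (x, x)) \<one> - hcomp (E (x, x)) k"
      using hcomp_mul_left[OF kc one_closed v(1) Ex] kc v Ex by (simp add: hcomp_diff)
    ultimately show ?thesis using x v Ex by (auto simp: J_def)
  qed
  have zero: "hcomp (E (x, x)) k (x, x) = 0" if "k \<in> supp - H x" for k
    using that supp_carrier hcomp_D[OF Ex] by (auto simp: H_def)
  have "1 = E (x, x) (x, x)" by (simp add: matrix_unit_apply)
  also have "\<dots> = (\<Sum>k\<in>supp. hcomp (E (x, x)) k) (x, x)" using Ex by (simp add: hcomp_sum_supp)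
  also have "\<dots> = (\<Sum>k\<in>supp. hcomp (E (x, x)) k (x, x))" by (rule fun_sum_apply)
  also have "\<dots> = (\<Sum>k\<in>H x. hcomp (E (x, x)) k (x, x))"
    using H_subset_supp zero by (intro sum.mono_neutral_right) auto
  also have "\<dots> = of_nat (card (H x)) * hcomp (E (x, x)) \<one> (x, x)"
    using eq by simp
  finally show ?thesis by simp
qed

lemma CHAR_not_dvd_card_H: "x \<in> X \<Longrightarrow> \<not> CHAR('f) dvd card (H x)"
  using card_H_unit[of x] by (auto simp flip: of_nat_eq_0_iff_char_dvd)

section \<open>Block indicators, characters and the exponent\<close>

lemma block_separation:
  assumes x: "x \<in> X" and Y: "finite Y" "Y \<subseteq> X - block x"
  shows "\<exists>f\<in>D \<one>. f (x, x) = 1 \<and> (\<forall>y\<in>Y. f (y, y) = 0)"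
  using Y
proof (induction Y)
  case empty
  then show ?case using U_homogeneous x by (auto intro!: bexI[of _ U])
next
  case (insert y Y)
  then obtain f where f: "f \<in> D \<one>" "f (x, x) = 1" "\<forall>z\<in>Y. f (z, z) = 0" by auto
  obtain c where c: "c \<in> D \<one>" "c (y, y) \<noteq> c (x, x)" using insert.prems by (auto simp: block_def)
  \<comment> \<open>As in Lagrange interpolation: a combination of \<open>c\<close> and
    \<open>U\<close> with value 1 at \<open>x\<close> and 0 at \<open>y\<close>, by which the
    earlier separating element is multiplied.\<close>
  define b where "b = fscale (1 / (c (x, x) - c (y, y))) (c - fscale (c (y, y)) U)"
  have b: "b \<in> D \<one>" using c U_homogeneous by (auto simp: b_def intro!: D_closed)
  have "b (x, x) = 1" "b (y, y) = 0" using c x insert.prems by (auto simp: b_def)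
  moreover have "f \<star> b \<in> D \<one>" using D_mult[OF one_closed one_closed f(1) b] by simp
  moreover have "f \<in> A" "b \<in> A" using f b D_in_A by auto
  ultimately show ?case using f x insert.prems by (intro bexI[of _ "f \<star> b"]) (auto simp: subset_iff)
qed

lemma block_indicator:
  assumes x: "x \<in> X"
  obtains f where "f \<in> D \<one>" "\<And>y. y \<in> X \<Longrightarrow> f (y, y) = (if y \<in> block x then 1 else 0)"
proof -
  obtain f where f: "f \<in> D \<one>" "f (x, x) = 1" "\<forall>y\<in>X - block x. f (y, y) = 0"
    using block_separation[OF x, of "X - block x"] finite_X by auto
  show thesis using that[OF f(1)] f block_one[OF f(1), of _ x] by auto
qed

text \<open>If \<open>v\<close> were 1 on the whole block, then \<open>v \<star> f\<close> and the
  block indicator \<open>f\<close> would agree modulo \<open>J\<close> in the distinct degrees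
  \<open>h\<close> and 1. Since \<open>J\<close> is graded, \<open>f\<close> itself would lie in
  \<open>J\<close>.\<close>

lemma characters_separate:
  assumes x: "x \<in> X" and h: "h \<in> H x" "h \<noteq> \<one>" and v: "v \<in> D h" "v (x, x) = 1"
  obtains y where "y \<in> block x" "v (y, y) \<noteq> 1"
proof (rule ccontr)
  assume "\<not> thesis"
  then have v1: "\<And>y. y \<in> block x \<Longrightarrow> v (y, y) = 1" using that by blast
  have hc: "h \<in> carrier G" using h by (simp add: H_def)
  obtain f where f: "f \<in> D \<one>" "\<And>y. y \<in> X \<Longrightarrow> f (y, y) = (if y \<in> block x then 1 else 0)"
    using block_indicator[OF x] by metis
  have A: "v \<in> A" "f \<in> A" using v f hc D_in_A by auto
  have vf: "v \<star> f \<in> D h" using D_mult[OF hc one_closed v(1) f(1)] hc by simp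
  have "v \<star> f - f \<in> J" using A f v1 by (auto simp: J_def)
  then have "hcomp (v \<star> f - f) \<one> \<in> J" by (rule J_graded)
  then have "0 - f \<in> J"
    using A h hc by (simp add: hcomp_diff hcomp_homogeneous[OF hc vf] hcomp_homogeneous[OF one_closed f(1)])
  then show False using f(2)[OF x] x block_refl[OF x] by (auto simp: J_def)
qed

text \<open>The order of \<open>H x\<close> is a common exponent, so the least one exists; the last
  fact is its minimality.\<close>

lemma group_exponent_H:
  assumes x: "x \<in> X"
  shows "group_exponent G (H x) > 0" "\<And>h. h \<in> H x \<Longrightarrow> h [^] group_exponent G (H x) = \<one>"
    "\<And>n. 0 < n \<Longrightarrow> n < group_exponent G (H x) \<Longrightarrow> \<exists>h\<in>H x. h [^] n \<noteq> \<one>"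
proof -
  interpret S: group "G\<lparr>carrier := H x\<rparr>"
    using H_subgroup[OF x] subgroup_imp_group by blast
  have "h [^] card (H x) = \<one>" if "h \<in> H x" for h
    using S.pow_order_eq_1[of h] that by (simp add: order_def nat_pow_consistent[symmetric])
  moreover have "card (H x) > 0" using one_in_H[OF x] by (auto simp: card_gt_0_iff)
  ultimately have ex: "\<exists>n::nat. n > 0 \<and> (\<forall>h\<in>H x. h [^] n = \<one>)" by blast
  show "group_exponent G (H x) > 0" "\<And>h. h \<in> H x \<Longrightarrow> h [^] group_exponent G (H x) = \<one>"
    using LeastI_ex[OF ex] by (auto simp: group_exponent_def)
  show "\<And>n. 0 < n \<Longrightarrow> n < group_exponent G (H x) \<Longrightarrow> \<exists>h\<in>H x. h [^] n \<noteq> \<one>"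
    using not_less_Least unfolding group_exponent_def by blast
qed

text \<open>The number \<open>?N div p\<close> is too small to be an exponent, so some
  \<open>h\<close> has a nontrivial power. A point \<open>y\<close> of the block separates this
  power from 1, and the value at \<open>y\<close> of a normalized element of degree \<open>h\<close>
  is the witness for \<open>p\<close>.\<close>

lemma primitive_root_H:
  assumes x: "x \<in> X"
  shows "\<exists>z :: 'f. primitive_root_of_unity (group_exponent G (H x)) z"
proof (rule primitive_root_exists)
  let ?N = "group_exponent G (H x)"
  show "?N > 0" by (rule group_exponent_H[OF x])
  fix p assume p: "prime p" "p dvd ?N"
  have "0 < ?N div p" "?N div p < ?N"
    using p group_exponent_H(1)[OF x] prime_gt_1_nat[OF p(1)] by (auto simp: dvd_imp_le div_greater_zero_iff)
  then obtain h where h: "h \<in> H x" "h [^] (?N div p) \<noteq> \<one>"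
    using group_exponent_H(3)[OF x] by blast
  have hc: "h \<in> carrier G" using h by (simp add: H_def)
  obtain v where v: "v \<in> D h" "v \<in> A" "v (x, x) = 1" using H_normalized[OF x h(1)] .
  have "conv_power v n \<in> D (h [^] n)" for n using conv_power_D[OF hc v(1)] .
  moreover have "conv_power v n (x, x) = 1" for n using v x by simp
  moreover have "h [^] (?N div p) \<in> H x"
    using calculation hc by (auto simp: H_def intro!: bexI[of _ "conv_power v (?N div p)"])
  ultimately obtain y where y: "y \<in> block x" "conv_power v (?N div p) (y, y) \<noteq> 1"
    using characters_separate[OF x _ h(2)] by metis
  have yX: "y \<in> X" using y block_X by blast
  have "conv_power v ?N \<in> D \<one>" using conv_power_D[OF hc v(1), of ?N] group_exponent_H(2)[OF x h(1)] by simp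
  then have "conv_power v ?N (y, y) = conv_power v ?N (x, x)" using y block_one by blast
  then have "v (y, y) ^ ?N = 1" using v x yX by simp
  then show "\<exists>w :: 'f. w ^ ?N = 1 \<and> w ^ (?N div p) \<noteq> 1" using y v yX by auto
qed

end

context graded_incidence begin

section \<open>Lifting idempotents\<close>

text \<open>Counting the points below \<open>x\<close> instead of measuring chains reduces strict
  monotonicity to a strict inclusion of finite sets.\<close>

definition height :: "'x \<Rightarrow> nat" where
  "height x = card {z \<in> X. (z, x) \<in> r}"

lemma height_less:
  assumes "(x, y) \<in> r" "x \<noteq> y" shows "height x < height y"
  unfolding height_def
proof (rule psubset_card_mono)
  show "finite {z \<in> X. (z, y) \<in> r}" using finite_X by simp
  have "y \<in> X" using assms r_subset by blast
  then have "y \<in> {z \<in> X. (z, y) \<in> r}" "y \<notin> {z \<in> X. (z, x) \<in> r}"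
    using assms r_refl r_antisym by auto
  moreover have "{z \<in> X. (z, x) \<in> r} \<subseteq> {z \<in> X. (z, y) \<in> r}"
    using assms r_trans by blast
  ultimately show "{z \<in> X. (z, x) \<in> r} \<subset> {z \<in> X. (z, y) \<in> r}" by blast
qed

text \<open>A multiplicative filtration by how far nonzero entries climb. It has \<open>J\<close> in
  step 1 and vanishes beyond \<open>card X\<close>, and it stands in for the powers of the ideal
  \<open>J\<close>.\<close>

definition J_power :: "nat \<Rightarrow> ('x \<times> 'x \<Rightarrow> 'f) set" where
  "J_power k = {f \<in> A. \<forall>x y. f (x, y) \<noteq> 0 \<longrightarrow> height x + k \<le> height y}"

lemma J_power_add: "f \<in> J_power k \<Longrightarrow> g \<in> J_power k \<Longrightarrow> f + g \<in> J_power k"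
  unfolding J_power_def by (auto) (metis add.right_neutral)+

lemma J_power_diff: "f \<in> J_power k \<Longrightarrow> g \<in> J_power k \<Longrightarrow> f - g \<in> J_power k"
  unfolding J_power_def by (auto) (metis diff_0_right diff_self)+

lemma J_power_mono: "k \<le> l \<Longrightarrow> f \<in> J_power l \<Longrightarrow> f \<in> J_power k"
  unfolding J_power_def by fastforce

lemma J_power_mul:
  assumes "f \<in> J_power k" "g \<in> J_power l" shows "f \<star> g \<in> J_power (k + l)"
proof -
  have "height x + (k + l) \<le> height y" if nz: "(f \<star> g) (x, y) \<noteq> 0" for x y
  proof -
    obtain z where "f (x, z) * g (z, y) \<noteq> 0"
      using nz unfolding conv_apply by (meson sum.not_neutral_contains_not_neutral)
    then have "f (x, z) \<noteq> 0" "g (z, y) \<noteq> 0" by auto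
    then show ?thesis using assms unfolding J_power_def by fastforce
  qed
  then show ?thesis using assms by (auto simp: J_power_def)
qed

lemma J_subset_J_power: "f \<in> J \<Longrightarrow> f \<in> J_power 1"
  unfolding J_power_def
proof safe
  fix x y assume f: "f \<in> J" "f (x, y) \<noteq> 0"
  then have "(x, y) \<in> r" using A_zero J_D by blast
  moreover have "x \<noteq> y" using f J_D(2) calculation r_subset by auto
  ultimately show "height x + 1 \<le> height y" using height_less by (simp add: Suc_le_eq)
qed (rule J_D)

lemma J_power_zero:
  assumes "f \<in> J_power k" "k > card X" shows "f = 0"
proof (rule ext, clarify)
  fix x y
  have "height y \<le> card X" unfolding height_def using finite_X by (intro card_mono) auto
  then show "f (x, y) = 0 (x, y)" using assms unfolding J_power_def by fastforce
qed

text \<open>An idempotent equals all its powers, which lie ever deeper in the filtration.\<close>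

lemma idempotent_in_J:
  assumes "f \<in> J" "f \<star> f = f" shows "f = 0"
proof -
  have "f \<in> J_power (Suc k)" for k
    by (induction k)
      (use J_subset_J_power[OF assms(1)] J_power_mul[of f _ f 1] assms(2) in \<open>auto simp: add.commute\<close>)
  then show ?thesis using J_power_zero[of f "Suc (card X)"] by simp
qed

text \<open>The Newton step \<open>f \<mapsto> 3 f\<^sup>2 - 2 f\<^sup>3\<close> squares the error \<open>f\<^sup>2 - f\<close> up to a factor.\<close>

definition newton :: "('x \<times> 'x \<Rightarrow> 'f) \<Rightarrow> 'x \<times> 'x \<Rightarrow> 'f" where
  "newton f = f \<star> f + f \<star> f + f \<star> f - f \<star> (f \<star> f) - f \<star> (f \<star> f)"

text \<open>With \<open>n\<close> the old error, the new one is four times the cube of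
  \<open>n\<close> minus three times its square, the coefficients being written as repeated sums.
  Its depth at least doubles; starting from depth 1, this gains at least one step.\<close>

lemma newton_error:
  assumes "f \<in> A" "f \<star> f - f \<in> J_power (Suc k)"
  shows "newton f \<star> newton f - newton f \<in> J_power (Suc (Suc k))"
proof -
  define n where "n = f \<star> f - f"
  define m where "m = n \<star> n"
  have "newton f \<star> newton f - newton f = n \<star> m + n \<star> m + n \<star> m + n \<star> m - m - m - m"
    unfolding newton_def m_def n_def by (simp only: conv_distribs conv_assoc) (simp add: algebra_simps)
  moreover have n: "n \<in> J_power (Suc k)" using assms by (simp only: n_def)
  moreover have m: "m \<in> J_power (Suc k + Suc k)"
    unfolding m_def by (rule J_power_mul[OF n n])
  moreover have nm: "n \<star> m \<in> J_power (Suc k + Suc k)"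
    by (rule J_power_mono[OF _ J_power_mul[OF n m]]) simp
  ultimately have "newton f \<star> newton f - newton f \<in> J_power (Suc k + Suc k)"
    by (simp only:) (intro J_power_add J_power_diff m nm)
  then show ?thesis by (rule J_power_mono[rotated]) simp
qed

lemma newton_D:
  assumes "f \<in> D \<one>" shows "newton f \<in> D \<one>"
proof -
  have "f \<star> f \<in> D \<one>" "f \<star> (f \<star> f) \<in> D \<one>"
    using D_mult[OF one_closed one_closed, of f f]
      D_mult[OF one_closed one_closed, of f "f \<star> f"] assms by auto
  then show ?thesis unfolding newton_def by (intro D_closed one_closed)
qed

text \<open>The Newton polynomial has no constant term, so it preserves degree 1 and the equations
  with \<open>e\<close>; it fixes 0 and 1, hence the diagonal.\<close>

lemma lift_idempotent:
  assumes f: "f \<in> D \<one>" "e \<star> f = f" "f \<star> e = f" and diag: "\<And>x. x \<in> X \<Longrightarrow> f (x, x) \<in> {0, 1}"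
  obtains f' where "f' \<in> D \<one>" "f' \<star> f' = f'" "e \<star> f' = f'" "f' \<star> e = f'"
    "\<And>x. x \<in> X \<Longrightarrow> f' (x, x) = f (x, x)"
proof -
  have "\<exists>f'\<in>D \<one>. f' \<star> f' - f' \<in> J_power (Suc k) \<and> e \<star> f' = f' \<and> f' \<star> e = f' \<and>
      (\<forall>x\<in>X. f' (x, x) = f (x, x))" for k
  proof (induction k)
    case 0
    have "f \<star> f - f \<in> J" using f(1) diag D_in_A[OF one_closed] by (fastforce simp: J_def)
    then have "f \<star> f - f \<in> J_power (Suc 0)" using J_subset_J_power by simp
    with f show ?case by blast
  next
    case (Suc k)
    then obtain f' where f': "f' \<in> D \<one>" "f' \<star> f' - f' \<in> J_power (Suc k)" "e \<star> f' = f'" "f' \<star> e = f'"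
      "\<forall>x\<in>X. f' (x, x) = f (x, x)" by blast
    have A: "f' \<in> A" using f' D_in_A by blast
    have "e \<star> newton f' = newton f'"
      unfolding newton_def by (simp only: conv_distribs f'(3) flip: conv_assoc)
    moreover have "newton f' \<star> e = newton f'"
      unfolding newton_def by (simp only: conv_distribs f'(4) conv_assoc)
    moreover have "newton f' (x, x) = f (x, x)" if "x \<in> X" for x
      using that A f'(5) diag[OF that] by (auto simp: newton_def)
    ultimately show ?case using newton_D f'(1) newton_error[OF A f'(2)] by blast
  qed
  \<comment> \<open>The error now lies in \<open>J_power (Suc (card X))\<close>, which is 0.\<close>
  from this[of "card X"] show thesis
    using that J_power_zero[of _ "Suc (card X)"] by (metis eq_iff_diff_eq_0 lessI)
qed

text \<open>Induction on \<open>n\<close>: the next candidate is compressed by the complement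
  \<open>c\<close> of the idempotents found so far and lifted inside the corner of \<open>c\<close>,
  which forces orthogonality to all of them.\<close>

lemma lift_orthogonal_idempotents:
  fixes S :: "nat \<Rightarrow> 'x set"
  assumes f: "\<And>i. i < t \<Longrightarrow> f i \<in> D \<one>"
      "\<And>i x. i < t \<Longrightarrow> x \<in> X \<Longrightarrow> f i (x, x) = (if x \<in> S i then 1 else 0)"
    and disj: "\<And>i j. i < t \<Longrightarrow> j < t \<Longrightarrow> i \<noteq> j \<Longrightarrow> S i \<inter> S j = {}"
    and n: "n \<le> t"
  shows "\<exists>e. (\<forall>i<n. e i \<in> D \<one> \<and> (\<forall>x\<in>X. e i (x, x) = (if x \<in> S i then 1 else 0))) \<and>
    (\<forall>i<n. \<forall>j<n. e i \<star> e j = (if i = j then e i else 0))"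
  using n
proof (induction n)
  case (Suc n)
  then have "n \<le> t" by simp
  from Suc.IH[OF this] obtain e where e_all:
    "(\<forall>i<n. e i \<in> D \<one> \<and> (\<forall>x\<in>X. e i (x, x) = (if x \<in> S i then 1 else 0))) \<and>
    (\<forall>i<n. \<forall>j<n. e i \<star> e j = (if i = j then e i else 0))" ..
  then have e: "\<And>i. i < n \<Longrightarrow> e i \<in> D \<one>"
    "\<And>i x. i < n \<Longrightarrow> x \<in> X \<Longrightarrow> e i (x, x) = (if x \<in> S i then 1 else 0)"
    "\<And>i j. i < n \<Longrightarrow> j < n \<Longrightarrow> e i \<star> e j = (if i = j then e i else 0)"
    by blast+
  have eA: "e i \<in> A" if "i < n" for i using e(1)[OF that] D_in_A by blast
  define c where "c = U - (\<Sum>i<n. e i)"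
  have c: "c \<in> D \<one>" using e U_homogeneous by (auto simp: c_def intro!: D_closed)
  have cA: "c \<in> A" using c D_in_A by blast
  have sum_e: "(\<Sum>i<n. e i) \<star> e j = e j" "e j \<star> (\<Sum>i<n. e i) = e j" if "j < n" for j
  proof -
    have "(\<Sum>i<n. e i) \<star> e j = (\<Sum>i<n. if i = j then e j else 0)"
      unfolding conv_sum_left by (rule sum.cong) (use that e(3) in auto)
    then show "(\<Sum>i<n. e i) \<star> e j = e j" using that by simp
    have "e j \<star> (\<Sum>i<n. e i) = (\<Sum>i<n. if i = j then e j else 0)"
      unfolding conv_sum_right by (rule sum.cong) (use that e(3) in auto)
    then show "e j \<star> (\<Sum>i<n. e i) = e j" using that by simp
  qed
  have ce: "c \<star> e j = 0" "e j \<star> c = 0" if "j < n" for j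
    using sum_e[OF that] eA[OF that] by (simp_all add: c_def conv_distribs)
  have cc: "c \<star> c = c"
  proof -
    have "c \<star> c = c \<star> U - (\<Sum>i<n. c \<star> e i)"
      by (subst (2) c_def) (simp add: conv_distribs conv_sum_right)
    then show ?thesis using ce cA by simp
  qed
  define f0 where "f0 = c \<star> f n \<star> c"
  have n: "n < t" using Suc.prems by simp
  have fA: "f n \<in> A" using f(1)[OF n] D_in_A by blast
  have "f0 \<in> D \<one>"
    using D_mult[OF _ _ D_mult[OF _ _ c f(1)[OF n]] c] by (simp add: f0_def)
  moreover have cf: "c \<star> f0 = f0" "f0 \<star> c = f0"
    by (simp_all add: f0_def cc conv_assoc) (simp add: cc flip: conv_assoc)
  \<comment> \<open>On \<open>S n\<close> the earlier idempotents have diagonal 0 by disjointness,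
    so \<open>c\<close> is 1 there and the compression keeps the diagonal of
    \<open>f n\<close>.\<close>
  moreover have diag: "f0 (x, x) = (if x \<in> S n then 1 else 0)" if x: "x \<in> X" for x
  proof (cases "x \<in> S n")
    case True
    then have "e i (x, x) = 0" if "i < n" for i
      using disj[of i n] n that e(2) x by auto
    then have "c (x, x) = 1" using x by (simp add: c_def fun_sum_apply)
    then show ?thesis using True f(2)[OF n x] x cA fA by (simp add: f0_def)
  qed (use f(2)[OF n x] x cA fA in \<open>simp add: f0_def\<close>)
  ultimately obtain e' where e': "e' \<in> D \<one>" "e' \<star> e' = e'" "c \<star> e' = e'" "e' \<star> c = e'"
    "\<And>x. x \<in> X \<Longrightarrow> e' (x, x) = f0 (x, x)"
    using lift_idempotent[of f0 c] by (metis insert_iff)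
  have "e' \<star> e j = 0" "e j \<star> e' = 0" if "j < n" for j
  proof -
    have "e' \<star> e j = e' \<star> (c \<star> e j)" by (simp add: e' flip: conv_assoc)
    then show "e' \<star> e j = 0" using ce that by simp
    have "e j \<star> e' = e j \<star> c \<star> e'" by (simp add: e' conv_assoc)
    then show "e j \<star> e' = 0" using ce that by simp
  qed
  then show ?case
    using e e' diag by (intro exI[of _ "e(n := e')"]) (auto simp: less_Suc_eq)
qed simp

end

section \<open>Ordering the blocks\<close>

context radical_graded begin

definition rank :: "'x \<Rightarrow> nat" where
  "rank x = Max (height ` block x)"

text \<open>One point is chosen in each block and the list is sorted by \<open>rank\<close>. Ties
  are harmless because the comparison of heights in \<open>homogeneous_corner_row\<close> is
  strict.\<close>

lemma block_representatives:
  obtains xs where "set xs \<subseteq> X" "(\<Union>x\<in>set xs. block x) = X"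
    "\<And>i j. i < length xs \<Longrightarrow> j < length xs \<Longrightarrow> i \<noteq> j \<Longrightarrow> block (xs ! i) \<inter> block (xs ! j) = {}"
    "\<And>i j. i \<le> j \<Longrightarrow> j < length xs \<Longrightarrow> rank (xs ! i) \<le> rank (xs ! j)"
proof -
  define rep where "rep B = (SOME x. x \<in> X \<and> block x = B)" for B
  have rep: "rep (block x) \<in> X" "block (rep (block x)) = block x" if "x \<in> X" for x
    using someI[of "\<lambda>y. y \<in> X \<and> block y = block x" x] that by (auto simp: rep_def)
  define R where "R = (\<lambda>x. rep (block x)) ` X"
  have "finite R" using finite_X by (simp add: R_def)
  then obtain ys where ys: "set ys = R" "distinct ys" using finite_distinct_list by blast
  define xs where "xs = sort_key rank ys"
  have xs: "set xs = R" "distinct xs" using ys by (auto simp: xs_def)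
  have R: "block x \<inter> block y = {}" if "x \<in> R" "y \<in> R" "x \<noteq> y" for x y
  proof (rule ccontr)
    note xyR = that
    assume "block x \<inter> block y \<noteq> {}"
    then obtain z where z: "z \<in> block x" "z \<in> block y" by blast
    obtain x' y' where xy: "x' \<in> X" "y' \<in> X" "x = rep (block x')" "y = rep (block y')"
      using xyR unfolding R_def by blast
    then have "x \<in> X" "y \<in> X" using rep(1) by auto
    then have "block x = block y" using z block_eq by metis
    then show False using that xy rep(2) by metis
  qed
  show thesis
  proof (rule that[of xs])
    show "set xs \<subseteq> X" using xs rep by (auto simp: R_def)
    have "x \<in> (\<Union>x\<in>set xs. block x)" if "x \<in> X" for x
      using that xs rep(2)[OF that] block_refl[OF that] by (auto simp: R_def)
    then show "(\<Union>x\<in>set xs. block x) = X" using block_X by blast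
    show "block (xs ! i) \<inter> block (xs ! j) = {}"
      if "i < length xs" "j < length xs" "i \<noteq> j" for i j
      using R xs that nth_eq_iff_index_eq nth_mem by metis
    have "sorted (map rank xs)" by (simp add: xs_def)
    then show "rank (xs ! i) \<le> rank (xs ! j)" if "i \<le> j" "j < length xs" for i j
      using that sorted_nth_mono[of "map rank xs" i j] by simp
  qed
qed

text \<open>The sum runs over \<open>z\<close> above \<open>w\<close> only, and there column
  \<open>y\<close> of \<open>b\<close> vanishes except at \<open>w\<close> itself.\<close>

lemma mul_apply_maximal:
  assumes "a \<in> A" "w \<in> X" "\<And>z. (w, z) \<in> r \<Longrightarrow> z \<noteq> w \<Longrightarrow> b (z, y) = 0"
  shows "(a \<star> b) (w, y) = a (w, w) * b (w, y)"
proof -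
  have "(a \<star> b) (w, y) = (\<Sum>z\<in>X. if z = w then a (w, w) * b (w, y) else 0)"
    unfolding conv_apply
  proof (rule sum.cong)
    fix z
    show "a (w, z) * b (z, y) = (if z = w then a (w, w) * b (w, y) else 0)"
      using assms A_zero[OF assms(1), of "(w, z)"] by (cases "(w, z) \<in> r") auto
  qed simp
  then show ?thesis using finite_X assms by simp
qed

lemma mul_apply_minimal:
  assumes "a \<in> A" "w \<in> X" "\<And>z. (z, w) \<in> r \<Longrightarrow> z \<noteq> w \<Longrightarrow> b (y, z) = 0"
  shows "(b \<star> a) (y, w) = b (y, w) * a (w, w)"
proof -
  have "(b \<star> a) (y, w) = (\<Sum>z\<in>X. if z = w then b (y, w) * a (w, w) else 0)"
    unfolding conv_apply
  proof (rule sum.cong)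
    fix z
    show "b (y, z) * a (z, w) = (if z = w then b (y, w) * a (w, w) else 0)"
      using assms A_zero[OF assms(1), of "(z, w)"] by (cases "(z, w) \<in> r") auto
  qed simp
  then show ?thesis using finite_X assms by simp
qed

end

section \<open>Peirce decomposition by the block idempotents\<close>

locale peirce = radical_graded G X r D
  for G :: "('g, 'h) monoid_scheme" (structure)
    and X :: "'x set" and r :: "('x \<times> 'x) set"
    and D :: "'g \<Rightarrow> ('x \<times> 'x \<Rightarrow> 'f::field) set" +
  fixes xs :: "'x list" and e :: "nat \<Rightarrow> 'x \<times> 'x \<Rightarrow> 'f"
  assumes xs_X: "set xs \<subseteq> X"
    and rank_mono: "i \<le> j \<Longrightarrow> j < length xs \<Longrightarrow> rank (xs ! i) \<le> rank (xs ! j)"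
    and e_D: "i < length xs \<Longrightarrow> e i \<in> D \<one>"
    and e_diag: "i < length xs \<Longrightarrow> x \<in> X \<Longrightarrow> e i (x, x) = (if x \<in> block (xs ! i) then 1 else 0)"
    and e_mul: "i < length xs \<Longrightarrow> j < length xs \<Longrightarrow> e i \<star> e j = (if i = j then e i else 0)"
    and e_sum: "(\<Sum>i<length xs. e i) = U"
begin

abbreviation t :: nat where "t \<equiv> length xs"

lemma xs_nth: "i < t \<Longrightarrow> xs ! i \<in> X"
  using xs_X nth_mem by blast

lemma e_A [simp]: "i < t \<Longrightarrow> e i \<in> A"
  using e_D D_in_A by blast

text \<open>Fixed-point equations, rather than the image of a projection, make closure under sums
  and products immediate.\<close>

definition corner :: "nat \<Rightarrow> nat \<Rightarrow> ('x \<times> 'x \<Rightarrow> 'f) set" where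
  "corner i j = {b \<in> A. e i \<star> b = b \<and> b \<star> e j = b}"

lemma corner_A: "b \<in> corner i j \<Longrightarrow> b \<in> A"
  and corner_left: "b \<in> corner i j \<Longrightarrow> e i \<star> b = b"
  and corner_right: "b \<in> corner i j \<Longrightarrow> b \<star> e j = b"
  by (auto simp: corner_def)

lemma corner_subspace: "fun_space.subspace (corner i j)"
  by (auto simp: fun_space.subspace_def corner_def conv_distribs conv_scale_left conv_scale_right)

lemmas corner_closed [intro] =
  fun_space.subspace_0[OF corner_subspace] fun_space.subspace_add[OF corner_subspace]
  fun_space.subspace_diff[OF corner_subspace] fun_space.subspace_scale[OF corner_subspace]
  fun_space.subspace_sum[OF corner_subspace]

lemma corner_mul: "b \<in> corner i j \<Longrightarrow> c \<in> corner j k \<Longrightarrow> b \<star> c \<in> corner i k"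
  by (auto simp: corner_def conv_assoc) (simp flip: conv_assoc)

lemma corner_proj:
  assumes "i < t" "j < t" "a \<in> A" shows "e i \<star> a \<star> e j \<in> corner i j"
proof -
  have "e i \<star> (e i \<star> a \<star> e j) = e i \<star> a \<star> e j" "e i \<star> a \<star> e j \<star> e j = e i \<star> a \<star> e j"
    using assms e_mul by (simp_all add: conv_assoc) (simp flip: conv_assoc)
  then show ?thesis using assms by (simp add: corner_def mul_in_A)
qed

lemma proj_corner:
  assumes "b \<in> corner i j" "i < t" "j < t" "k < t" "l < t"
  shows "e k \<star> b \<star> e l = (if k = i \<and> l = j then b else 0)"
proof -
  have "e k \<star> b \<star> e l = e k \<star> (e i \<star> b \<star> e j) \<star> e l"
    using assms by (simp add: corner_left corner_right)
  also have "\<dots> = (e k \<star> e i) \<star> b \<star> (e j \<star> e l)" by (simp add: conv_assoc)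
  also have "\<dots> = (if k = i \<and> l = j then b else 0)"
    using assms e_mul by (auto simp: corner_left corner_right)
  finally show ?thesis .
qed

text \<open>The idempotents have degree 1, so the Peirce projections preserve degrees.\<close>

lemma hcomp_proj:
  assumes "i < t" "j < t" "a \<in> A" shows "hcomp (e i \<star> a \<star> e j) g = e i \<star> hcomp a g \<star> e j"
proof (cases "g \<in> carrier G")
  case True
  have "hcomp (e i \<star> a \<star> e j) g = hcomp (e i \<star> a) g \<star> e j"
    using hcomp_mul_right[OF one_closed True e_D[OF assms(2)], of "e i \<star> a"] assms True by auto
  also have "hcomp (e i \<star> a) g = e i \<star> hcomp a g"
    using hcomp_mul_left[OF one_closed True e_D[OF assms(1)], of a] assms True by auto
  finally show ?thesis .
next
  case False
  then show ?thesis using assms hcomp_outside[OF _ False] by (auto simp: hcomp_outside)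
qed

lemma hcomp_corner:
  assumes "i < t" "j < t" "b \<in> corner i j" shows "hcomp b g \<in> corner i j"
proof -
  have "hcomp b g = e i \<star> hcomp b g \<star> e j"
    using hcomp_proj[OF assms(1,2) corner_A[OF assms(3)], of g] assms
    by (simp add: corner_left corner_right)
  then show ?thesis using corner_proj[OF assms(1,2), of "hcomp b g"] corner_A[OF assms(3)] by simp
qed

lemma A_peirce:
  assumes "a \<in> A" shows "a = (\<Sum>i<t. \<Sum>j<t. e i \<star> a \<star> e j)"
proof -
  have "a = U \<star> a \<star> U" using assms by simp
  also have "\<dots> = (\<Sum>i<t. \<Sum>j<t. e i \<star> a \<star> e j)"
    unfolding e_sum[symmetric] conv_sum_left conv_sum_right by (rule sum.swap)
  finally show ?thesis .
qed

text \<open>The component of degree \<open>1\<close> of \<open>E (x, x)\<close> acts injectively on the left of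
  \<open>e i \<star> A\<close>, so that row \<open>x\<close> of \<open>b\<close> cannot vanish. The lowest nonzero entry in this row lies in a
  column of block \<open>j\<close>.\<close>

lemma homogeneous_corner_row:
  assumes ij: "i < t" "j < t" and g: "g \<in> carrier G"
    and b: "b \<in> D g" "b \<in> corner i j" "b \<in> J" "b \<noteq> 0" and x: "x \<in> block (xs ! i)"
  obtains z where "z \<in> block (xs ! j)" "height x < height z"
proof -
  have xX: "x \<in> X" using x block_X by blast
  have Ex: "E (x, x) \<in> A" using xX r_refl by simp
  have bA: "b \<in> A" using b J_D by blast
  define f where "f = hcomp (E (x, x)) \<one>"
  have f: "f \<in> D \<one>" "f \<in> A" using Ex by (auto simp: f_def hcomp_D)
  have "f (x, x) \<noteq> 0" using card_H_unit[OF xX] by (auto simp: f_def)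
  then have f_block: "f (w, w) \<noteq> 0" if "w \<in> block (xs ! i)" for w
    using that block_one[OF f(1)] x by metis
  have "E (x, x) \<star> b \<noteq> 0"
  proof
    assume "E (x, x) \<star> b = 0"
    then have fb: "f \<star> b = 0"
      using hcomp_mul_right[OF g one_closed b(1) Ex] g by (simp add: f_def)
    obtain q0 where "b q0 \<noteq> 0" using b(4) by (auto simp: fun_eq_iff)
    have bd: "height (fst q) \<le> card X" for q
      unfolding height_def using finite_X by (intro card_mono) auto
    \<comment> \<open>On a nonzero entry in a row of greatest height, left multiplication acts by
      its diagonal value alone. The idempotent \<open>e i\<close> fixes this entry, so its row
      belongs to block \<open>i\<close>, where \<open>f\<close> has no zero.\<close>
    have "\<exists>q. b q \<noteq> 0 \<and> (\<forall>q'. b q' \<noteq> 0 \<longrightarrow> height (fst q') \<le> height (fst q))"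
      by (rule ex_has_greatest_nat[of _ q0 _ "Suc (card X)"]) (use \<open>b q0 \<noteq> 0\<close> bd in \<open>auto simp: less_Suc_eq_le\<close>)
    then obtain q where q: "b q \<noteq> 0" "\<forall>q'. b q' \<noteq> 0 \<longrightarrow> height (fst q') \<le> height (fst q)"
      by (elim exE conjE)
    obtain w y where wy: "q = (w, y)" by (cases q)
    have "w \<in> X" using q wy A_zero[OF bA] r_subset by blast
    moreover have "b (z, y) = 0" if "(w, z) \<in> r" "z \<noteq> w" for z
      using height_less[of w z] that q(2)[rule_format, of "(z, y)"] wy by fastforce
    ultimately have mul: "(a \<star> b) (w, y) = a (w, w) * b (w, y)" if "a \<in> A" for a
      using mul_apply_maximal that by blast
    have "e i (w, w) * b (w, y) = b (w, y)" using mul[of "e i"] ij corner_left[OF b(2)] by simp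
    then have "w \<in> block (xs ! i)"
      using q wy e_diag[OF ij(1) \<open>w \<in> X\<close>] by (auto split: if_splits)
    then show False using f_block mul[OF f(2)] fb q wy by auto
  qed
  then obtain p q where "(E (x, x) \<star> b) (p, q) \<noteq> 0" by (auto simp: fun_eq_iff)
  then have "b (x, q) \<noteq> 0" using xX by (auto simp: E_mul_left split: if_splits)
  then obtain z where z: "b (x, z) \<noteq> 0" "\<And>z'. b (x, z') \<noteq> 0 \<Longrightarrow> height z \<le> height z'"
    using ex_has_least_nat[of "\<lambda>z. b (x, z) \<noteq> 0" q height] by blast
  have xz: "(x, z) \<in> r" using z A_zero[OF bA] by blast
  then have zX: "z \<in> X" using r_subset by blast
  have "b (x, z') = 0" if "(z', z) \<in> r" "z' \<noteq> z" for z'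
    using height_less[of z' z] that z(2)[of z'] by fastforce
  then have "b (x, z) * e j (z, z) = b (x, z)"
    using mul_apply_minimal[of "e j" z b x] ij zX corner_right[OF b(2)] by simp
  then have "z \<in> block (xs ! j)"
    using z e_diag[OF ij(2) zX] by (auto split: if_splits)
  moreover have "x \<noteq> z" using z J_D(2)[OF b(3) xX] by auto
  ultimately show thesis using that height_less[OF xz] by blast
qed

text \<open>A nonzero homogeneous component would send a point of greatest height in block
  \<open>i\<close> to a strictly higher point of block \<open>j\<close>, against the order of the
  ranks. The case \<open>j = i\<close> is what turns the diagonal corners into group
  algebras.\<close>

lemma corner_J_zero:
  assumes ij: "i < t" "j \<le> i" and b: "b \<in> corner i j" "b \<in> J"
  shows "b = 0"
proof -
  have j: "j < t" using ij by simp
  have "hcomp b g = 0" if g: "g \<in> carrier G" for g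
  proof (rule ccontr)
    assume nz: "hcomp b g \<noteq> 0"
    have "rank (xs ! i) \<in> height ` block (xs ! i)"
      unfolding rank_def using block_refl[OF xs_nth[OF ij(1)]] by (intro Max_in) auto
    then obtain x where x: "x \<in> block (xs ! i)" "height x = rank (xs ! i)" by auto
    obtain z where "z \<in> block (xs ! j)" "height x < height z"
      using homogeneous_corner_row[OF ij(1) j g hcomp_D hcomp_corner[OF ij(1) j b(1)] J_graded nz x(1)]
        b corner_A g by metis
    moreover have "height z \<le> rank (xs ! j)"
      unfolding rank_def using calculation by (intro Max_ge) auto
    ultimately show False using x rank_mono[OF ij(2,1)] by simp
  qed
  then have "(\<Sum>g\<in>supp. hcomp b g) = 0"
    using supp_carrier by (intro sum.neutral) blast
  then show ?thesis using hcomp_sum_supp[OF corner_A[OF b(1)]] by simp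
qed

end

section \<open>Transport of graded algebras\<close>

text \<open>Spares a direct verification of the axioms for the matrix algebra. Scalar multiplication
  on the ambient type of \<open>B\<close> is beyond the reach of \<phi>, so its vector space laws
  are assumed.\<close>

lemma graded_algebra_transport:
  fixes G :: "('g, 'h) monoid_scheme"
    and A :: "('f::field, 'a::ab_group_add, 'g) graded_alg"
    and B :: "('f, 'b::ab_group_add, 'g) graded_alg"
  assumes "monoid G" and A: "graded_algebra G A" and vs: "vector_space (Scale B)"
    and iso: "graded_alg_iso G A B \<phi>"
  shows "graded_algebra G B"
proof -
  have gs: "graded_space G (Scale A) (Space A) (Comp A)"
    and bil: "bilinear_into (Scale A) (Scale A) (Scale A) (Space A) (Space A) (Space A) (Mult A)"
    and assoc: "\<And>a b c. a \<in> Space A \<Longrightarrow> b \<in> Space A \<Longrightarrow> c \<in> Space A \<Longrightarrow>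
        Mult A (Mult A a b) c = Mult A a (Mult A b c)"
    and unit: "Unit A \<in> Space A"
      "\<And>a. a \<in> Space A \<Longrightarrow> Mult A (Unit A) a = a" "\<And>a. a \<in> Space A \<Longrightarrow> Mult A a (Unit A) = a"
    and deg: "degree_compatible G (Comp A) (Comp A) (Comp A) (Mult A)"
    using A by (auto simp: graded_algebra_def)
  have bij: "inj_on \<phi> (Space A)" "Space B = \<phi> ` Space A"
    and add: "\<And>a b. a \<in> Space A \<Longrightarrow> b \<in> Space A \<Longrightarrow> \<phi> (a + b) = \<phi> a + \<phi> b"
    and scale: "\<And>c a. a \<in> Space A \<Longrightarrow> \<phi> (Scale A c a) = Scale B c (\<phi> a)"
    and mult: "\<And>a b. a \<in> Space A \<Longrightarrow> b \<in> Space A \<Longrightarrow> \<phi> (Mult A a b) = Mult B (\<phi> a) (\<phi> b)"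
    and unitB: "\<phi> (Unit A) = Unit B"
    and comp: "\<And>g. g \<in> carrier G \<Longrightarrow> Comp B g = \<phi> ` Comp A g"
    using iso by (auto simp: graded_alg_iso_def bij_betw_def)
  interpret va: vector_space "Scale A" using gs by (simp add: graded_space_def)
  interpret vb: vector_space "Scale B" by (rule vs)
  have sub: "va.subspace (Space A)"
    and subc: "\<And>g. g \<in> carrier G \<Longrightarrow> va.subspace (Comp A g)"
    and inc: "\<And>g. g \<in> carrier G \<Longrightarrow> Comp A g \<subseteq> Space A"
    and dec: "\<And>v. v \<in> Space A \<Longrightarrow> \<exists>!c. (\<forall>g\<in>carrier G. c g \<in> Comp A g) \<and>
        (\<forall>g. g \<notin> carrier G \<longrightarrow> c g = 0) \<and> finite {g. c g \<noteq> 0} \<and> v = (\<Sum>g | c g \<noteq> 0. c g)"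
    using gs by (auto simp: graded_space_def)
  have zA: "0 \<in> Space A" using va.subspace_0[OF sub] .
  have zero: "\<phi> 0 = 0" using add[OF zA zA] by simp
  have nz: "\<phi> a = 0 \<longleftrightarrow> a = 0" if "a \<in> Space A" for a
    using inj_onD[OF bij(1), of a 0] zero that zA by auto
  have sub_image: "vb.subspace (\<phi> ` S)" if S: "va.subspace S" "S \<subseteq> Space A" for S
  proof (rule vb.subspaceI)
    show "0 \<in> \<phi> ` S" using va.subspace_0[OF S(1)] zero by force
    show "x + y \<in> \<phi> ` S" if xy: "x \<in> \<phi> ` S" "y \<in> \<phi> ` S" for x y
    proof -
      obtain a b where ab: "a \<in> S" "b \<in> S" "x = \<phi> a" "y = \<phi> b" using xy by blast
      then have "x + y = \<phi> (a + b)" using add S(2) by (simp add: subset_iff)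
      then show ?thesis using ab va.subspace_add[OF S(1)] by blast
    qed
    show "Scale B c x \<in> \<phi> ` S" if x: "x \<in> \<phi> ` S" for c x
    proof -
      obtain a where a: "a \<in> S" "x = \<phi> a" using x by blast
      then have "Scale B c x = \<phi> (Scale A c a)" using scale S(2) by (simp add: subset_iff)
      then show ?thesis using a va.subspace_scale[OF S(1)] by blast
    qed
  qed
  have sum: "\<phi> (\<Sum>i\<in>I. f i) = (\<Sum>i\<in>I. \<phi> (f i)) \<and> (\<Sum>i\<in>I. f i) \<in> Space A"
    if "finite I" "\<And>i. i \<in> I \<Longrightarrow> f i \<in> Space A" for I :: "'g set" and f
    using that by (induction I) (auto simp: zero zA add va.subspace_add[OF sub])
  have "graded_space G (Scale B) (Space B) (Comp B)"
    unfolding graded_space_def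
  proof (intro conjI ballI)
    show "vector_space (Scale B)" by (rule vs)
    show "vb.subspace (Space B)" using sub_image[OF sub] bij by simp
    show "vb.subspace (Comp B g)" if "g \<in> carrier G" for g
      using sub_image[OF subc[OF that] inc[OF that]] comp[OF that] by simp
    show "Comp B g \<subseteq> Space B" if "g \<in> carrier G" for g
      using comp[OF that] inc[OF that] bij by auto
    fix v assume "v \<in> Space B"
    then obtain a where a: "a \<in> Space A" "v = \<phi> a" using bij by blast
    obtain c where c: "\<And>g. g \<in> carrier G \<Longrightarrow> c g \<in> Comp A g" "\<And>g. g \<notin> carrier G \<Longrightarrow> c g = 0"
      "finite {g. c g \<noteq> 0}" "a = (\<Sum>g | c g \<noteq> 0. c g)" using dec[OF a(1)] by blast
    have cS: "c g \<in> Space A" for g using c(1,2)[of g] inc zA by (cases "g \<in> carrier G") auto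
    show "\<exists>!c. (\<forall>g\<in>carrier G. c g \<in> Comp B g) \<and> (\<forall>g. g \<notin> carrier G \<longrightarrow> c g = 0) \<and>
      finite {g. c g \<noteq> 0} \<and> v = (\<Sum>g | c g \<noteq> 0. c g)"
    proof (rule ex1I[of _ "\<lambda>g. \<phi> (c g)"], intro conjI ballI allI impI)
      show "\<phi> (c g) \<in> Comp B g" if "g \<in> carrier G" for g using that c comp by auto
      show "\<phi> (c g) = 0" if "g \<notin> carrier G" for g using that c zero by auto
      show "finite {g. \<phi> (c g) \<noteq> 0}" using c cS nz by auto
      show "v = (\<Sum>g | \<phi> (c g) \<noteq> 0. \<phi> (c g))"
        unfolding a(2) using sum[OF c(3), of c] cS nz c(4) by simp
    next
      fix c' assume c': "(\<forall>g\<in>carrier G. c' g \<in> Comp B g) \<and> (\<forall>g. g \<notin> carrier G \<longrightarrow> c' g = 0) \<and>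
        finite {g. c' g \<noteq> 0} \<and> v = (\<Sum>g | c' g \<noteq> 0. c' g)"
      \<comment> \<open>A competing decomposition is pulled back degree by degree, so that
        uniqueness in \<open>A\<close> applies.\<close>
      have "\<exists>d. d \<in> Space A \<and> (if g \<in> carrier G then d \<in> Comp A g else d = 0) \<and> c' g = \<phi> d" for g
      proof (cases "g \<in> carrier G")
        case True
        then have "c' g \<in> \<phi> ` Comp A g" using c' comp by blast
        then obtain d where "d \<in> Comp A g" "c' g = \<phi> d" by blast
        then show ?thesis using True inc by auto
      next
        case False
        then show ?thesis using c' zero zA by auto
      qed
      then obtain d where d: "\<And>g. d g \<in> Space A"
        "\<And>g. if g \<in> carrier G then d g \<in> Comp A g else d g = 0" "\<And>g. c' g = \<phi> (d g)" by metis
      have supp: "{g. c' g \<noteq> 0} = {g. d g \<noteq> 0}" using d nz by auto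
      then have fin: "finite {g. d g \<noteq> 0}" using c' by simp
      have "v = (\<Sum>g | c' g \<noteq> 0. c' g)" using c' by blast
      also have "\<dots> = (\<Sum>g | d g \<noteq> 0. \<phi> (d g))" by (rule sum.cong[OF supp]) (rule d(3))
      also have "\<dots> = \<phi> (\<Sum>g | d g \<noteq> 0. d g)" using sum[OF fin, of d] d(1) by simp
      finally have "v = \<phi> (\<Sum>g | d g \<noteq> 0. d g)" .
      then have "a = (\<Sum>g | d g \<noteq> 0. d g)"
        using a inj_onD[OF bij(1)] sum[OF fin, of d] d(1) by auto
      then have "d = c"
        using dec[OF a(1)] fin d(2) c by (metis (no_types, lifting))
      then show "c' = (\<lambda>g. \<phi> (c g))" using d by auto
    qed
  qed
  moreover have "bilinear_into (Scale B) (Scale B) (Scale B) (Space B) (Space B) (Space B) (Mult B)"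
    unfolding bilinear_into_def bij(2)
  proof (intro conjI ballI allI; clarify)
    fix a b c assume S: "a \<in> Space A" "b \<in> Space A"
    note bil' = bil[unfolded bilinear_into_def]
    have ab: "Mult A a b \<in> Space A" using bil' S by blast
    then show "Mult B (\<phi> a) (\<phi> b) \<in> \<phi> ` Space A" using mult[OF S] by (metis imageI)
    { fix k
      have k: "Scale A k a \<in> Space A" "Scale A k b \<in> Space A"
        using S va.subspace_scale[OF sub] by auto
      show "Mult B (Scale B k (\<phi> a)) (\<phi> b) = Scale B k (Mult B (\<phi> a) (\<phi> b))"
        using mult[OF k(1) S(2)] mult[OF S] scale S ab bil' by metis
      show "Mult B (\<phi> a) (Scale B k (\<phi> b)) = Scale B k (Mult B (\<phi> a) (\<phi> b))"
        using mult[OF S(1) k(2)] mult[OF S] scale S ab bil' by metis }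
    assume c: "c \<in> Space A"
    have ac: "Mult A a c \<in> Space A" "Mult A b c \<in> Space A" using bil' S c by blast+
    have s: "a + b \<in> Space A" "b + c \<in> Space A" using S c va.subspace_add[OF sub] by auto
    show "Mult B (\<phi> a + \<phi> b) (\<phi> c) = Mult B (\<phi> a) (\<phi> c) + Mult B (\<phi> b) (\<phi> c)"
      using mult[OF s(1) c] mult[OF S(1) c] mult[OF S(2) c] add[OF S] add[OF ac] bil' S c by metis
    show "Mult B (\<phi> a) (\<phi> b + \<phi> c) = Mult B (\<phi> a) (\<phi> b) + Mult B (\<phi> a) (\<phi> c)"
      using mult[OF S(1) s(2)] mult[OF S] mult[OF S(1) c] add[OF S(2) c] add[OF ab ac(1)] bil' S c by metis
  qed
  moreover have "Mult B (Mult B x y) z = Mult B x (Mult B y z)"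
    if xyz: "x \<in> Space B" "y \<in> Space B" "z \<in> Space B" for x y z
  proof -
    obtain a b c where S: "a \<in> Space A" "b \<in> Space A" "c \<in> Space A" "x = \<phi> a" "y = \<phi> b" "z = \<phi> c"
      using xyz bij by blast
    then have "Mult A a b \<in> Space A" "Mult A b c \<in> Space A"
      using bil by (auto simp: bilinear_into_def)
    then show ?thesis using S mult assoc by metis
  qed
  moreover have "Unit B \<in> Space B" using unit(1) bij(2) by (metis imageI unitB)
  moreover have "Mult B (Unit B) x = x \<and> Mult B x (Unit B) = x" if "x \<in> Space B" for x
    using that unit mult unitB bij by (metis imageE)
  moreover have "degree_compatible G (Comp B) (Comp B) (Comp B) (Mult B)"
    unfolding degree_compatible_def
  proof (intro ballI)
    fix g h u v assume gh: "g \<in> carrier G" "h \<in> carrier G" and "u \<in> Comp B g" "v \<in> Comp B h"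
    then obtain a b where ab: "a \<in> Comp A g" "b \<in> Comp A h" "u = \<phi> a" "v = \<phi> b"
      using comp by auto
    then have "Mult A a b \<in> Comp A (g \<otimes>\<^bsub>G\<^esub> h)" "Mult B u v = \<phi> (Mult A a b)"
      using deg gh mult inc by (auto simp: degree_compatible_def subset_iff)
    moreover have "Comp B (g \<otimes>\<^bsub>G\<^esub> h) = \<phi> ` Comp A (g \<otimes>\<^bsub>G\<^esub> h)"
      using comp monoid.m_closed[OF assms(1) gh] .
    ultimately show "Mult B u v \<in> Comp B (g \<otimes>\<^bsub>G\<^esub> h)" by simp
  qed
  ultimately show ?thesis unfolding graded_algebra_def by auto
qed

section \<open>The block triangular form\<close>

context peirce begin

abbreviation FH :: "nat \<Rightarrow> ('f, 'g \<Rightarrow> 'f, 'g) graded_alg" where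
  "FH i \<equiv> group_algebra G (H (xs ! i))"

text \<open>Modulo \<open>J\<close>, block \<open>i\<close> is the group algebra of \<open>H (xs ! i)\<close> on the basis of homogeneous elements
  with value \<open>1\<close> at \<open>xs ! i\<close>; this is the map to the coordinates in this basis.\<close>

definition coord :: "nat \<Rightarrow> ('x \<times> 'x \<Rightarrow> 'f) \<Rightarrow> 'g \<Rightarrow> 'f" where
  "coord i a = (\<lambda>h. hcomp a h (xs ! i, xs ! i))"

lemma coord_in_FH:
  assumes "a \<in> A" shows "coord i a \<in> Space (FH i)"
proof -
  have "{h. coord i a h \<noteq> 0} \<subseteq> H (xs ! i)"
  proof
    fix h assume h: "h \<in> {h. coord i a h \<noteq> 0}"
    then have "h \<in> carrier G" using hcomp_outside[OF assms, of h]
      by (cases "h \<in> carrier G") (auto simp: coord_def)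
    then show "h \<in> H (xs ! i)" using h hcomp_D[OF assms] by (auto simp: coord_def H_def)
  qed
  then show ?thesis
    using finite_subset[OF _ finite_H] by (auto simp: group_algebra_def)
qed

lemma coord_add: "a \<in> A \<Longrightarrow> b \<in> A \<Longrightarrow> coord i (a + b) = coord i a + coord i b"
  and coord_scale: "a \<in> A \<Longrightarrow> coord i (fscale c a) = fscale c (coord i a)"
  and coord_diff: "a \<in> A \<Longrightarrow> b \<in> A \<Longrightarrow> coord i (a - b) = coord i a - coord i b"
  by (auto simp: coord_def hcomp_add hcomp_scale hcomp_diff fun_eq_iff)

text \<open>Evaluation at the base point is multiplicative, so the component formula for products
  becomes the convolution in the group algebra.\<close>

lemma coord_mul:
  assumes i: "i < t" and ab: "a \<in> A" "b \<in> A"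
  shows "coord i (a \<star> b) = Mult (FH i) (coord i a) (coord i b)"
proof
  fix k
  let ?S = "{(g, h). coord i a g \<noteq> 0 \<and> coord i b h \<noteq> 0 \<and> g \<otimes> h = k}"
  have nz: "g \<in> supp" if "a \<in> A" "coord i a g \<noteq> 0" for a g
    using that hcomp_not_supp[of a g] by (cases "g \<in> supp") (auto simp: coord_def)
  have "coord i (a \<star> b) k =
    (\<Sum>g\<in>supp. \<Sum>h\<in>supp. if g \<otimes> h = k then coord i a g * coord i b h else 0)"
    unfolding coord_def by (rule diag_hcomp_mul[OF ab xs_nth[OF i]])
  also have "\<dots> = (\<Sum>(g, h)\<in>supp \<times> supp. if g \<otimes> h = k then coord i a g * coord i b h else 0)"
    by (rule sum.cartesian_product)
  also have "\<dots> = (\<Sum>(g, h)\<in>?S. coord i a g * coord i b h)"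
    using nz[OF ab(1)] nz[OF ab(2)]
    by (intro sum.mono_neutral_cong_right) (auto split: if_splits)
  also have "\<dots> = Mult (FH i) (coord i a) (coord i b) k"
    by (simp add: group_algebra_def)
  finally show "coord i (a \<star> b) k = Mult (FH i) (coord i a) (coord i b) k" .
qed

lemma coord_U: "i < t \<Longrightarrow> coord i U = Unit (FH i)"
  using xs_nth by (auto simp: coord_def group_algebra_def hcomp_homogeneous[OF one_closed U_homogeneous])

lemma coord_D: "g \<in> carrier G \<Longrightarrow> a \<in> D g \<Longrightarrow> coord i a \<in> Comp (FH i) g"
  using coord_in_FH[of a i] D_in_A[of g a]
  by (auto simp: group_algebra_def coord_def hcomp_homogeneous split: if_splits)

section \<open>Diagonal corners as group algebras\<close>

lemma coord_proj:
  assumes "i < t" "a \<in> A" shows "coord i (e i \<star> a \<star> e i) = coord i a"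
  using assms xs_nth[OF assms(1)] block_refl e_diag by (auto simp: coord_def hcomp_proj)

lemma proj_in_J:
  assumes "i < t" "j < t" "i \<noteq> j" "a \<in> A" shows "e i \<star> a \<star> e j \<in> J"
proof -
  have "e i (y, y) * a (y, y) * e j (y, y) = 0" if y: "y \<in> X" for y
  proof -
    have "e i (y, y) * e j (y, y) = (e i \<star> e j) (y, y)" using assms y by simp
    then have "e i (y, y) * e j (y, y) = 0" using e_mul assms by simp
    then show ?thesis by auto
  qed
  then show ?thesis using assms by (auto simp: J_def)
qed

lemma proj_lower_zero:
  assumes "i < t" "j < i" "a \<in> A" shows "e i \<star> a \<star> e j = 0"
  using corner_J_zero[of i j "e i \<star> a \<star> e j"] proj_in_J[of i j a] corner_proj[of i j a] assms by simp

text \<open>Each component of \<open>b\<close> vanishes at the base point, hence on its block; off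
  the block the factor \<open>e i\<close> kills the diagonal. So \<open>b\<close> lies in
  \<open>J\<close>, which meets \<open>corner i i\<close> only in 0.\<close>

lemma coord_inj:
  assumes i: "i < t" and b: "b \<in> corner i i" "coord i b = 0" shows "b = 0"
proof (rule corner_J_zero[OF i _ b(1)])
  have bA: "b \<in> A" using b corner_A by blast
  have "b (y, y) = 0" if y: "y \<in> X" for y
  proof (cases "y \<in> block (xs ! i)")
    case True
    have "hcomp b g (y, y) = 0" if "g \<in> carrier G" for g
      using zero_block[OF that hcomp_D[OF bA that] _ xs_nth[OF i] True] b(2)
      by (auto simp: coord_def fun_eq_iff)
    then have "(\<Sum>g\<in>supp. hcomp b g (y, y)) = 0"
      using supp_carrier by (intro sum.neutral) blast
    then have "(\<Sum>g\<in>supp. hcomp b g) (y, y) = 0" by (simp only: fun_sum_apply)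
    then show ?thesis using hcomp_sum_supp[OF bA] by simp
  next
    case False
    have "b (y, y) = (e i \<star> b) (y, y)" using corner_left[OF b(1)] by simp
    also have "\<dots> = 0" using False e_diag[OF i y] y bA i by simp
    finally show ?thesis .
  qed
  then show "b \<in> J" using bA by (simp add: J_def)
qed simp

text \<open>Normalized homogeneous elements are combined with the coefficients \<alpha>; compression
  to the corner leaves the coordinates unchanged.\<close>

lemma coord_surj:
  assumes i: "i < t" and \<alpha>: "\<alpha> \<in> Space (FH i)"
  obtains b where "b \<in> corner i i" "coord i b = \<alpha>"
proof -
  define x where "x = xs ! i"
  have x: "x \<in> X" using xs_nth[OF i] by (simp add: x_def)
  have "\<exists>v. v \<in> D h \<and> v \<in> A \<and> v (x, x) = 1" if "h \<in> H x" for h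
    using H_normalized[OF x that] by metis
  then obtain v where v: "\<And>h. h \<in> H x \<Longrightarrow> v h \<in> D h \<and> v h \<in> A \<and> v h (x, x) = 1" by metis
  define a where "a = (\<Sum>h\<in>H x. fscale (\<alpha> h) (v h))"
  have aA: "a \<in> A" using v by (auto simp: a_def)
  have "coord i a k = \<alpha> k" for k
  proof -
    have "hcomp a k = (\<Sum>h\<in>H x. fscale (\<alpha> h) (hcomp (v h) k))"
      using v by (simp add: a_def hcomp_sum hcomp_scale)
    then have "coord i a k = (\<Sum>h\<in>H x. \<alpha> h * hcomp (v h) k (x, x))"
      by (simp add: coord_def x_def fun_sum_apply)
    also have "\<dots> = (\<Sum>h\<in>H x. if h = k then \<alpha> k else 0)"
    proof (rule sum.cong)
      fix h assume h: "h \<in> H x"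
      then have "h \<in> carrier G" by (simp add: H_def)
      then show "\<alpha> h * hcomp (v h) k (x, x) = (if h = k then \<alpha> k else 0)"
        using v[OF h] by (auto simp: hcomp_homogeneous)
    qed simp
    also have "\<dots> = \<alpha> k" using \<alpha> by (auto simp: group_algebra_def x_def)
    finally show ?thesis .
  qed
  then have "coord i a = \<alpha>" by blast
  then show thesis
    using that[OF corner_proj[OF i i aA]] coord_proj[OF i aA] by simp
qed

text \<open>The inverse of \<open>coord i\<close> on \<open>corner i i\<close>, through which the
  group algebra acts on the other corners.\<close>

definition lift :: "nat \<Rightarrow> ('g \<Rightarrow> 'f) \<Rightarrow> 'x \<times> 'x \<Rightarrow> 'f" where
  "lift i \<alpha> = (SOME b. b \<in> corner i i \<and> coord i b = \<alpha>)"

lemma lift_props: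
  assumes "i < t" "\<alpha> \<in> Space (FH i)"
  shows lift_corner: "lift i \<alpha> \<in> corner i i" and coord_lift: "coord i (lift i \<alpha>) = \<alpha>"
proof -
  have "\<exists>b. b \<in> corner i i \<and> coord i b = \<alpha>" using coord_surj[OF assms] by metis
  then have "lift i \<alpha> \<in> corner i i \<and> coord i (lift i \<alpha>) = \<alpha>"
    unfolding lift_def by (rule someI_ex)
  then show "lift i \<alpha> \<in> corner i i" "coord i (lift i \<alpha>) = \<alpha>" by auto
qed

text \<open>Since \<open>coord i\<close> is injective on the corner, the algebraic laws for
  \<open>lift\<close> reduce to those for coordinates.\<close>

lemma lift_unique:
  assumes "i < t" "b \<in> corner i i" "coord i b = \<alpha>" shows "lift i \<alpha> = b"
proof -
  have \<alpha>: "\<alpha> \<in> Space (FH i)" using coord_in_FH[OF corner_A[OF assms(2)]] assms(3) by blast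
  note l = lift_props[OF assms(1) \<alpha>]
  have "lift i \<alpha> - b = 0"
    using l assms corner_A[OF l(1)] corner_A[OF assms(2)]
    by (intro coord_inj[OF assms(1)]) (auto simp: coord_diff)
  then show ?thesis by simp
qed

lemma lift_coord: "i < t \<Longrightarrow> a \<in> A \<Longrightarrow> lift i (coord i a) = e i \<star> a \<star> e i"
  by (intro lift_unique corner_proj coord_proj)

lemma lift_A: "i < t \<Longrightarrow> \<alpha> \<in> Space (FH i) \<Longrightarrow> lift i \<alpha> \<in> A"
  using lift_corner corner_A by blast

lemma lift_add:
  assumes "i < t" "\<alpha> \<in> Space (FH i)" "\<beta> \<in> Space (FH i)"
  shows "lift i (\<alpha> + \<beta>) = lift i \<alpha> + lift i \<beta>"
  using assms by (intro lift_unique) (auto simp: coord_add lift_A coord_lift lift_corner)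

lemma lift_scale:
  assumes "i < t" "\<alpha> \<in> Space (FH i)"
  shows "lift i (fscale c \<alpha>) = fscale c (lift i \<alpha>)"
  using assms by (intro lift_unique) (auto simp: coord_scale lift_A coord_lift lift_corner)

lemma lift_mult:
  assumes "i < t" "\<alpha> \<in> Space (FH i)" "\<beta> \<in> Space (FH i)"
  shows "lift i (Mult (FH i) \<alpha> \<beta>) = lift i \<alpha> \<star> lift i \<beta>"
  using assms by (intro lift_unique) (auto simp: coord_mul lift_A coord_lift intro: corner_mul[OF lift_corner lift_corner])

lemma lift_unit: "i < t \<Longrightarrow> lift i (Unit (FH i)) = e i"
  using lift_coord[of i U] e_mul[of i i] by (simp add: coord_U)

text \<open>Passing to the component of degree \<open>g\<close> keeps the coordinates of the lift,
  so by uniqueness the lift is that component.\<close>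

lemma lift_D:
  assumes i: "i < t" and g: "g \<in> carrier G" and \<alpha>: "\<alpha> \<in> Comp (FH i) g"
  shows "lift i \<alpha> \<in> D g"
proof -
  have \<alpha>': "\<alpha> \<in> Space (FH i)" using \<alpha> finite_subset[of _ "{g}"] by (auto simp: group_algebra_def)
  note l = lift_props[OF i \<alpha>']
  have A: "lift i \<alpha> \<in> A" using lift_A[OF i \<alpha>'] .
  have "lift i \<alpha> = hcomp (lift i \<alpha>) g"
  proof (rule lift_unique[OF i hcomp_corner[OF i i l(1)]])
    show "coord i (hcomp (lift i \<alpha>) g) = \<alpha>"
    proof
      fix k
      have "coord i (hcomp (lift i \<alpha>) g) k = (if k = g then coord i (lift i \<alpha>) g else 0)"
        using hcomp_homogeneous[OF g hcomp_D[OF A g]] by (simp add: coord_def)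
      also have "\<dots> = \<alpha> k" using \<alpha> by (auto simp: l group_algebra_def)
      finally show "coord i (hcomp (lift i \<alpha>) g) k = \<alpha> k" .
    qed
  qed
  then show ?thesis using hcomp_D[OF A g] by simp
qed

section \<open>Off-diagonal corners as graded bimodules\<close>

definition M :: "nat \<Rightarrow> nat \<Rightarrow> ('g \<Rightarrow> 'f, 'g \<Rightarrow> 'f, 'x \<times> 'x \<Rightarrow> 'f, 'g) graded_bimod" where
  "M i j = \<lparr>BSpace = corner i j, LAct = (\<lambda>\<alpha> m. lift i \<alpha> \<star> m), RAct = (\<lambda>m \<beta>. m \<star> lift j \<beta>),
    BComp = (\<lambda>g. corner i j \<inter> D g)\<rparr>"

lemma graded_space_corner:
  assumes "i < t" "j < t" shows "graded_space G fscale (corner i j) (\<lambda>g. corner i j \<inter> D g)"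
  unfolding graded_space_def
proof (intro conjI ballI)
  show "vector_space (fscale :: 'f \<Rightarrow> ('x \<times> 'x \<Rightarrow> 'f) \<Rightarrow> _)" by (rule fun_space.vector_space_axioms)
  show "fun_space.subspace (corner i j)" by (rule corner_subspace)
  show "fun_space.subspace (corner i j \<inter> D g)" if "g \<in> carrier G" for g
    using corner_subspace D_subspace[OF that] by (rule fun_space.subspace_inter)
  show "corner i j \<inter> D g \<subseteq> corner i j" for g by blast
  fix v assume v: "v \<in> corner i j"
  have vA: "v \<in> A" using v corner_A by blast
  show "\<exists>!c. (\<forall>g\<in>carrier G. c g \<in> corner i j \<inter> D g) \<and> (\<forall>g. g \<notin> carrier G \<longrightarrow> c g = 0) \<and>
      finite {g. c g \<noteq> 0} \<and> v = (\<Sum>g | c g \<noteq> 0. c g)"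
  proof (rule ex1I[of _ "hcomp v"], intro conjI ballI allI impI)
    show "v = (\<Sum>g | hcomp v g \<noteq> 0. hcomp v g)" by (rule hcomp_total[OF vA])
    show "finite {g. hcomp v g \<noteq> 0}" by (rule hcomp_finite[OF vA])
    show "hcomp v g \<in> corner i j \<inter> D g" if "g \<in> carrier G" for g
      using hcomp_corner[OF assms v] hcomp_D[OF vA that] by blast
    show "hcomp v g = 0" if "g \<notin> carrier G" for g by (rule hcomp_outside[OF vA that])
  next
    fix c assume "(\<forall>g\<in>carrier G. c g \<in> corner i j \<inter> D g) \<and> (\<forall>g. g \<notin> carrier G \<longrightarrow> c g = 0) \<and>
      finite {g. c g \<noteq> 0} \<and> v = (\<Sum>g | c g \<noteq> 0. c g)"
    then show "c = hcomp v" by (intro hcomp_unique[of "{g. c g \<noteq> 0}", symmetric]) auto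
  qed
qed

lemma graded_bimodule_M:
  assumes ij: "i < t" "j < t" shows "graded_bimodule G fscale (FH i) (FH j) (M i j)"
  unfolding graded_bimodule_def
proof (intro conjI)
  show "graded_space G fscale (BSpace (M i j)) (BComp (M i j))"
    using graded_space_corner[OF ij] by (simp add: M_def)
  have scale: "Scale (FH i) = fscale" for i by (simp add: group_algebra_def)
  show "bilinear_into (Scale (FH i)) fscale fscale (Space (FH i)) (BSpace (M i j)) (BSpace (M i j)) (LAct (M i j))"
    unfolding bilinear_into_def scale using ij
    by (auto simp: M_def lift_add lift_scale conv_distribs conv_scale_left conv_scale_right
        intro: corner_mul[OF lift_corner])
  show "bilinear_into fscale (Scale (FH j)) fscale (BSpace (M i j)) (Space (FH j)) (BSpace (M i j)) (RAct (M i j))"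
    unfolding bilinear_into_def scale using ij
    by (auto simp: M_def lift_add lift_scale conv_distribs conv_scale_left conv_scale_right
        intro: corner_mul[OF _ lift_corner])
  show "\<forall>a\<in>Space (FH i). \<forall>a'\<in>Space (FH i). \<forall>m\<in>BSpace (M i j).
      LAct (M i j) (Mult (FH i) a a') m = LAct (M i j) a (LAct (M i j) a' m)"
    using ij by (simp add: M_def lift_mult conv_assoc)
  show "\<forall>m\<in>BSpace (M i j). \<forall>b\<in>Space (FH j). \<forall>b'\<in>Space (FH j).
      RAct (M i j) m (Mult (FH j) b b') = RAct (M i j) (RAct (M i j) m b) b'"
    using ij by (simp add: M_def lift_mult conv_assoc)
  show "\<forall>a\<in>Space (FH i). \<forall>m\<in>BSpace (M i j). \<forall>b\<in>Space (FH j).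
      RAct (M i j) (LAct (M i j) a m) b = LAct (M i j) a (RAct (M i j) m b)"
    by (simp add: M_def conv_assoc)
  show "\<forall>m\<in>BSpace (M i j). LAct (M i j) (Unit (FH i)) m = m \<and> RAct (M i j) m (Unit (FH j)) = m"
    using ij by (simp add: M_def lift_unit corner_left corner_right)
  have Comp_Space: "\<alpha> \<in> Space (FH i)" if "\<alpha> \<in> Comp (FH i) g" for \<alpha> g i
    using that finite_subset[of _ "{g}"] by (auto simp: group_algebra_def)
  show "degree_compatible G (Comp (FH i)) (BComp (M i j)) (BComp (M i j)) (LAct (M i j))"
    unfolding degree_compatible_def using ij Comp_Space
    by (auto simp: M_def intro: corner_mul[OF lift_corner] D_mult lift_D)
  show "degree_compatible G (BComp (M i j)) (Comp (FH j)) (BComp (M i j)) (RAct (M i j))"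
    unfolding degree_compatible_def using ij Comp_Space
    by (auto simp: M_def intro: corner_mul[OF _ lift_corner] D_mult lift_D)
qed

lemma triangular_data_M: "triangular_data G fscale t (\<lambda>i. H (xs ! i)) M (\<lambda>i j k. (\<star>))"
  unfolding triangular_data_def
proof (intro conjI allI impI; elim conjE)
  show "graded_bimodule G fscale (FH i) (FH j) (M i j)" if "i < j" "j < t" for i j
    using that by (intro graded_bimodule_M) auto
  fix i j k :: nat
  show "bilinear_into fscale fscale fscale (BSpace (M i j)) (BSpace (M j k)) (BSpace (M i k)) (\<star>)"
    by (auto simp: bilinear_into_def M_def conv_distribs conv_scale_left conv_scale_right intro: corner_mul)
  show "degree_compatible G (BComp (M i j)) (BComp (M j k)) (BComp (M i k)) (\<star>)"
    by (auto simp: degree_compatible_def M_def intro: corner_mul D_mult)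
qed

section \<open>The isomorphism with the block triangular algebra\<close>

abbreviation T :: "('f, (nat \<Rightarrow> 'g \<Rightarrow> 'f) \<times> (nat \<Rightarrow> nat \<Rightarrow> 'x \<times> 'x \<Rightarrow> 'f), 'g) graded_alg" where
  "T \<equiv> triangular_algebra G fscale t (\<lambda>i. H (xs ! i)) M (\<lambda>i j k. (\<star>))"

definition \<phi> :: "('x \<times> 'x \<Rightarrow> 'f) \<Rightarrow> (nat \<Rightarrow> 'g \<Rightarrow> 'f) \<times> (nat \<Rightarrow> nat \<Rightarrow> 'x \<times> 'x \<Rightarrow> 'f)" where
  "\<phi> a = (\<lambda>i. if i < t then coord i a else 0,
    \<lambda>i j. if i < j \<and> j < t then e i \<star> a \<star> e j else 0)"

lemma vector_space_T: "vector_space (Scale T)"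
  by standard (auto simp: triangular_algebra_def Let_def fscale_def fun_eq_iff algebra_simps)

lemma Space_T: "(d, m) \<in> Space T \<longleftrightarrow>
    (\<forall>i. if i < t then d i \<in> Space (FH i) else d i = 0) \<and>
    (\<forall>i j. if i < j \<and> j < t then m i j \<in> corner i j else m i j = 0)"
  by (simp add: triangular_algebra_def Let_def M_def)

lemma Comp_T: "(d, m) \<in> Comp T g \<longleftrightarrow>
    (\<forall>i. if i < t then d i \<in> Comp (FH i) g else d i = 0) \<and>
    (\<forall>i j. if i < j \<and> j < t then m i j \<in> corner i j \<inter> D g else m i j = 0)"
  by (simp add: triangular_algebra_def Let_def M_def)

lemma \<phi>_Space: "a \<in> A \<Longrightarrow> \<phi> a \<in> Space T"
  by (auto simp: \<phi>_def Space_T coord_in_FH intro: corner_proj)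

text \<open>All corners of the difference vanish: those on the diagonal by their coordinates, those
  above it by \<phi>, and those below it by triangularity.\<close>

lemma \<phi>_inj:
  assumes "a \<in> A" "b \<in> A" "\<phi> a = \<phi> b" shows "a = b"
proof -
  define c where "c = a - b"
  have c: "c \<in> A" using assms by (simp add: c_def)
  have coords: "coord i c = 0" if "i < t" for i
    using assms that by (auto simp: c_def coord_diff \<phi>_def fun_eq_iff[of "\<lambda>i. if i < t then _ i else 0"] split: if_splits)
  have "e i \<star> c \<star> e j = 0" if ij: "i < t" "j < t" for i j
  proof -
    consider "i = j" | "i < j" | "j < i" by linarith
    then show ?thesis
    proof cases
      case 1
      then show ?thesis
        using coord_inj[OF ij(1) corner_proj[OF ij(1,1) c]] coord_proj[OF ij(1) c] coords[OF ij(1)] by simp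
    next
      case 2
      have "snd (\<phi> a) i j = snd (\<phi> b) i j" using assms by simp
      then show ?thesis using 2 ij by (simp add: \<phi>_def c_def conv_distribs)
    qed (use proj_lower_zero c ij in simp)
  qed
  then have "c = 0" using A_peirce[OF c] by simp
  then show ?thesis by (simp add: c_def)
qed

text \<open>The preimage is the sum of the entries, the diagonal ones being lifted. The last
  conclusion gives surjectivity in each degree.\<close>

lemma \<phi>_preimage:
  assumes dm: "(d, m) \<in> Space T"
  obtains a where "a \<in> A" "\<phi> a = (d, m)"
    "\<And>g. g \<in> carrier G \<Longrightarrow> (d, m) \<in> Comp T g \<Longrightarrow> a \<in> D g"
proof -
  have d: "\<And>i. i < t \<Longrightarrow> d i \<in> Space (FH i)" "\<And>i. \<not> i < t \<Longrightarrow> d i = 0"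
    and m: "\<And>i j. i < j \<Longrightarrow> j < t \<Longrightarrow> m i j \<in> corner i j"
      "\<And>i j. \<not> (i < j \<and> j < t) \<Longrightarrow> m i j = 0"
    using dm unfolding Space_T by meson+
  define q where "q i j = (if i = j then lift i (d i) else if i < j then m i j else 0)" for i j
  have q: "q i j \<in> corner i j" if "i < t" "j < t" for i j
    using that d m lift_corner by (auto simp: q_def)
  define a where "a = (\<Sum>i<t. \<Sum>j<t. q i j)"
  have aA: "a \<in> A" unfolding a_def by (intro A_closed corner_A[OF q]) auto
  have proj: "e k \<star> a \<star> e l = q k l" if kl: "k < t" "l < t" for k l
  proof -
    have "e k \<star> a \<star> e l = (\<Sum>i<t. \<Sum>j<t. e k \<star> q i j \<star> e l)"
      by (simp only: a_def conv_sum_left conv_sum_right)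
    also have "\<dots> = (\<Sum>i<t. \<Sum>j<t. if j = l then (if i = k then q k l else 0) else 0)"
      using proj_corner[OF q _ _ kl] by (intro sum.cong) auto
    also have "\<dots> = q k l" using kl by simp
    finally show ?thesis .
  qed
  have "coord k a = d k" if k: "k < t" for k
    using coord_proj[OF k aA] proj[OF k k] coord_lift[OF k d(1)[OF k]] by (simp add: q_def)
  then have "\<phi> a = (d, m)"
    using proj d m by (auto simp: \<phi>_def q_def fun_eq_iff)
  moreover have "a \<in> D g" if g: "g \<in> carrier G" and c: "(d, m) \<in> Comp T g" for g
  proof -
    have "q i j \<in> D g" if ij: "i < t" "j < t" for i j
    proof -
      have "d i \<in> Comp (FH i) g" using c ij unfolding Comp_T by meson
      moreover have "m i j \<in> D g" if "i < j" using c that ij unfolding Comp_T by (meson IntD2)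
      ultimately show ?thesis
        using lift_D[OF ij(1) g] fun_space.subspace_0[OF D_subspace[OF g]] by (auto simp: q_def)
    qed
    then show ?thesis unfolding a_def using g by (auto intro!: D_closed)
  qed
  ultimately show thesis using that aA by blast
qed

text \<open>The unit is inserted between \<open>a\<close> and \<open>b\<close> as the sum of the
  \<open>e j\<close>; the terms \<open>j = i\<close> and \<open>j = k\<close> are the two bimodule
  actions.\<close>

lemma \<phi>_mult:
  assumes ab: "a \<in> A" "b \<in> A" shows "\<phi> (a \<star> b) = Mult T (\<phi> a) (\<phi> b)"
proof -
  have upper: "e i \<star> (a \<star> b) \<star> e k = lift i (coord i a) \<star> (e i \<star> b \<star> e k) +
      (e i \<star> a \<star> e k) \<star> lift k (coord k b) +
      (\<Sum>j\<in>{i<..<k}. (e i \<star> a \<star> e j) \<star> (e j \<star> b \<star> e k))" if ik: "i < k" "k < t" for i k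
  proof -
    let ?s = "\<lambda>j. (e i \<star> a \<star> e j) \<star> (e j \<star> b \<star> e k)"
    have i: "i < t" using ik by simp
    have s: "?s j = e i \<star> a \<star> e j \<star> b \<star> e k" if "j < t" for j
    proof -
      have "?s j = e i \<star> a \<star> (e j \<star> e j) \<star> b \<star> e k" by (simp add: conv_assoc)
      then show ?thesis using e_mul[OF that that] by simp
    qed
    have "e i \<star> (a \<star> b) \<star> e k = e i \<star> a \<star> U \<star> b \<star> e k"
      using ab i by (simp add: conv_assoc mul_in_A)
    also have "\<dots> = (\<Sum>j<t. e i \<star> a \<star> e j \<star> b \<star> e k)"
      by (simp only: conv_sum_left conv_sum_right flip: e_sum)
    also have "\<dots> = (\<Sum>j<t. ?s j)" using s by simp
    also have "\<dots> = (\<Sum>j\<in>insert i (insert k {i<..<k}). ?s j)"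
    proof (rule sum.mono_neutral_right)
      \<comment> \<open>For these \<open>j\<close> one of the two factors is a corner below the
        diagonal.\<close>
      show "\<forall>j\<in>{..<t} - insert i (insert k {i<..<k}). ?s j = 0"
      proof
        fix j assume j: "j \<in> {..<t} - insert i (insert k {i<..<k})"
        then consider "j < i" | "k < j" "j < t" by auto
        then show "?s j = 0"
          using proj_lower_zero[of i j a] proj_lower_zero[of j k b] i ab by cases auto
      qed
    qed (use ik in auto)
    also have "\<dots> = ?s i + (?s k + (\<Sum>j\<in>{i<..<k}. ?s j))"
      using ik by simp
    finally show ?thesis using ab i ik by (simp add: lift_coord add.assoc)
  qed
  show ?thesis
  proof (rule prod_eqI)
    show "fst (\<phi> (a \<star> b)) = fst (Mult T (\<phi> a) (\<phi> b))"
      using ab by (auto simp: \<phi>_def triangular_algebra_def Let_def coord_mul)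
    show "snd (\<phi> (a \<star> b)) = snd (Mult T (\<phi> a) (\<phi> b))"
    proof (rule ext, rule ext)
      fix i k
      have sum: "(\<Sum>j\<in>{i<..<k}. (if i < j \<and> j < t then e i \<star> a \<star> e j else 0) \<star>
            (if j < k \<and> k < t then e j \<star> b \<star> e k else 0)) =
          (\<Sum>j\<in>{i<..<k}. (e i \<star> a \<star> e j) \<star> (e j \<star> b \<star> e k))" if "k < t"
        using that by (intro sum.cong) auto
      show "snd (\<phi> (a \<star> b)) i k = snd (Mult T (\<phi> a) (\<phi> b)) i k"
        using upper[of i k] sum by (simp add: \<phi>_def triangular_algebra_def Let_def M_def)
    qed
  qed
qed

lemma \<phi>_iso: "graded_alg_iso G (incidence_algebra X r D) T \<phi>"
  unfolding graded_alg_iso_def incidence_algebra_eq graded_alg.simps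
proof (intro conjI ballI allI)
  show "bij_betw \<phi> A (Space T)"
    unfolding bij_betw_def
  proof
    show "inj_on \<phi> A" using \<phi>_inj by (auto intro: inj_onI)
    show "\<phi> ` A = Space T"
    proof
      show "\<phi> ` A \<subseteq> Space T" using \<phi>_Space by blast
      show "Space T \<subseteq> \<phi> ` A"
      proof
        fix z assume z: "z \<in> Space T"
        obtain d m where dm: "z = (d, m)" by (cases z)
        obtain a where "a \<in> A" "\<phi> a = (d, m)" using \<phi>_preimage z unfolding dm by blast
        then show "z \<in> \<phi> ` A" unfolding dm by (metis imageI)
      qed
    qed
  qed
  show "\<phi> (a + b) = \<phi> a + \<phi> b" if "a \<in> A" "b \<in> A" for a b
    using that by (auto simp: \<phi>_def coord_add conv_distribs fun_eq_iff)
  show "\<phi> (fscale c a) = Scale T c (\<phi> a)" if "a \<in> A" for c a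
    using that by (auto simp: \<phi>_def triangular_algebra_def Let_def coord_scale conv_scale_left
        conv_scale_right fun_eq_iff)
  show "\<phi> (a \<star> b) = Mult T (\<phi> a) (\<phi> b)" if "a \<in> A" "b \<in> A" for a b
    using \<phi>_mult that .
  have "e i \<star> U \<star> e j = 0" if "i < j" "j < t" for i j
    using e_mul[of i j] that by simp
  then show "\<phi> U = Unit T"
    by (auto simp: \<phi>_def triangular_algebra_def Let_def coord_U fun_eq_iff)
  show "\<phi> ` D g = Comp T g" if g: "g \<in> carrier G" for g
  proof
    show "\<phi> ` D g \<subseteq> Comp T g"
    proof
      fix z assume "z \<in> \<phi> ` D g"
      then obtain a where a: "a \<in> D g" "z = \<phi> a" by blast
      have aA: "a \<in> A" using a g D_in_A by blast
      have "e i \<star> a \<star> e j \<in> D g" if "i < t" "j < t" for i j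
        using D_mult[OF g one_closed D_mult[OF one_closed g e_D[OF that(1)] a(1), unfolded l_one[OF g]] e_D[OF that(2)]]
          g by simp
      then show "z \<in> Comp T g"
        unfolding a(2) \<phi>_def Comp_T using aA a g by (auto simp: coord_D intro: corner_proj)
    qed
    show "Comp T g \<subseteq> \<phi> ` D g"
    proof
      fix z assume z: "z \<in> Comp T g"
      obtain d m where dm: "z = (d, m)" by (cases z)
      have Comp_Space: "\<alpha> \<in> Space (FH i)" if "\<alpha> \<in> Comp (FH i) g" for \<alpha> i
        using that finite_subset[of _ "{g}"] by (auto simp: group_algebra_def)
      have "(d, m) \<in> Space T" using z Comp_Space unfolding dm Space_T Comp_T by (metis IntD1)
      then obtain a where "\<phi> a = (d, m)" "a \<in> D g"
        using \<phi>_preimage z g unfolding dm by blast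
      then show "z \<in> \<phi> ` D g" unfolding dm by (metis imageI)
    qed
  qed
qed

end

section \<open>Existence of a complete system of block idempotents\<close>

lemma (in radical_graded) peirce_exists: "\<exists>xs e. peirce G X r D xs e"
proof -
  obtain xs where xs: "set xs \<subseteq> X" "(\<Union>x\<in>set xs. block x) = X"
    "\<And>i j. i < length xs \<Longrightarrow> j < length xs \<Longrightarrow> i \<noteq> j \<Longrightarrow> block (xs ! i) \<inter> block (xs ! j) = {}"
    "\<And>i j. i \<le> j \<Longrightarrow> j < length xs \<Longrightarrow> rank (xs ! i) \<le> rank (xs ! j)"
    using block_representatives by metis
  let ?t = "length xs"
  have "\<exists>f. f \<in> D \<one> \<and> (\<forall>x\<in>X. f (x, x) = (if x \<in> block (xs ! i) then 1 else 0))" if "i < ?t" for i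
    using block_indicator[of "xs ! i"] xs(1) that by (metis nth_mem subsetD)
  then obtain f where f: "\<And>i. i < ?t \<Longrightarrow> f i \<in> D \<one>"
    "\<And>i x. i < ?t \<Longrightarrow> x \<in> X \<Longrightarrow> f i (x, x) = (if x \<in> block (xs ! i) then 1 else 0)"
    by metis
  have "\<exists>e. (\<forall>i<?t. e i \<in> D \<one> \<and> (\<forall>x\<in>X. e i (x, x) = (if x \<in> block (xs ! i) then 1 else 0))) \<and>
    (\<forall>i<?t. \<forall>j<?t. e i \<star> e j = (if i = j then e i else 0))"
    by (rule lift_orthogonal_idempotents[of ?t f]) (use f xs(3) in auto)
  then obtain e where e: "\<And>i. i < ?t \<Longrightarrow> e i \<in> D \<one>"
    "\<And>i x. i < ?t \<Longrightarrow> x \<in> X \<Longrightarrow> e i (x, x) = (if x \<in> block (xs ! i) then 1 else 0)"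
    "\<And>i j. i < ?t \<Longrightarrow> j < ?t \<Longrightarrow> e i \<star> e j = (if i = j then e i else 0)"
    by blast
  have eA: "e i \<in> A" if "i < ?t" for i using e(1)[OF that] D_in_A by blast
  define s where "s = (\<Sum>i<?t. e i)"
  have sA: "s \<in> A" using eA by (auto simp: s_def)
  have "s \<star> s = (\<Sum>i<?t. \<Sum>j<?t. if j = i then e i else 0)"
    unfolding s_def conv_sum_left conv_sum_right using e(3) by (intro sum.cong) auto
  then have ss: "s \<star> s = s" by (simp add: s_def)
  have "s (x, x) = 1" if x: "x \<in> X" for x
  proof -
    obtain y where "y \<in> set xs" "x \<in> block y" using x xs(2) by blast
    then obtain k where k: "k < ?t" "x \<in> block (xs ! k)" by (metis in_set_conv_nth)
    have "s (x, x) = (\<Sum>i<?t. e i (x, x))" unfolding s_def by (rule fun_sum_apply)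
    also have "\<dots> = (\<Sum>i<?t. if i = k then 1 else 0)"
      using e(2)[OF _ x] k xs(3) by (intro sum.cong) auto
    finally show ?thesis using k by simp
  qed
  \<comment> \<open>The lifted idempotents add up to 1 modulo \<open>J\<close>; the defect is an
    idempotent in \<open>J\<close> and therefore 0.\<close>
  then have "U - s \<in> J" using sA by (auto simp: J_def)
  moreover have "(U - s) \<star> (U - s) = U - s" using sA ss by (simp add: conv_distribs)
  ultimately have "U - s = 0" by (rule idempotent_in_J)
  then have "(\<Sum>i<?t. e i) = U" by (simp add: s_def)
  then have "peirce G X r D xs e"
    by unfold_locales (use xs e in auto)
  then show ?thesis by blast
qed

theorem theorem1:
  fixes G :: "('g, 'h) monoid_scheme"
    and X :: "'x set" and r :: "('x \<times> 'x) set"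
    and D :: "'g \<Rightarrow> ('x \<times> 'x \<Rightarrow> 'f::field) set"
  assumes "group G"
    and "finite X" and "partial_order_on X r"
    and "graded_algebra G (incidence_algebra X r D)"
    and "CHAR('f) = 0
      \<or> CHAR('f) > vector_space.dim (fscale :: 'f \<Rightarrow> _) (incidence_space r :: ('x \<times> 'x \<Rightarrow> 'f) set)
      \<or> comm_group G"
  shows "\<exists>(t :: nat) (H :: nat \<Rightarrow> 'g set)
      (M :: nat \<Rightarrow> nat \<Rightarrow> ('g \<Rightarrow> 'f, 'g \<Rightarrow> 'f, 'x \<times> 'x \<Rightarrow> 'f, 'g) graded_bimod) p \<phi>.
    (\<forall>i<t. subgroup (H i) G \<and> comm_group (G\<lparr>carrier := H i\<rparr>) \<and> finite (H i)
       \<and> \<not> CHAR('f) dvd card (H i)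
       \<and> (\<exists>z :: 'f. primitive_root_of_unity (group_exponent G (H i)) z))
    \<and> triangular_data G fscale t H M p
    \<and> graded_algebra G (triangular_algebra G fscale t H M p)
    \<and> graded_alg_iso G (incidence_algebra X r D) (triangular_algebra G fscale t H M p) \<phi>"
proof -
  interpret graded_incidence G X r D
    using assms by (simp add: graded_incidence_def graded_incidence_axioms_def)
  interpret radical_graded G X r D
    by unfold_locales (rule J_graded[OF assms(5)])
  obtain xs e where "peirce G X r D xs e" using peirce_exists by blast
  then interpret peirce G X r D xs e .
  have "graded_algebra G T"
    using graded_algebra_transport[OF is_monoid graded vector_space_T \<phi>_iso] .
  moreover have "subgroup (H (xs ! i)) G \<and> comm_group (G\<lparr>carrier := H (xs ! i)\<rparr>) \<and> finite (H (xs ! i))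
      \<and> \<not> CHAR('f) dvd card (H (xs ! i))
      \<and> (\<exists>z :: 'f. primitive_root_of_unity (group_exponent G (H (xs ! i))) z)" if "i < t" for i
    using H_subgroup H_comm_group CHAR_not_dvd_card_H primitive_root_H xs_nth[OF that] finite_H by blast
  ultimately show ?thesis
    using triangular_data_M \<phi>_iso
    by (intro exI[of _ t] exI[of _ "\<lambda>i. H (xs ! i)"] exI[of _ M] exI[of _ "\<lambda>i j k. conv X"] exI[of _ \<phi>]) blast
qed

end
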